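(* Let $x\ge0$ be the initial state. The following hold almost surely. (i) The estimator $\hat\gamma=\hat\gamma(\tau)$ in the LTO algorithm satisfies $\hat\gamma\to\gamma$ as $\tau\to\infty$. (ii) The estimator $\hat\gamma_k$ in the AU algorithm satisfies $\hat\gamma_k\to\gamma$ as $k\to\infty$. (iii) The estimator $\tilde\gamma_k$ in the AU-FH algorithm satisfies $\tilde\gamma_k\to\gamma$ as $k\to\infty$.
   Context: Setting. $B$ is a standard Brownian motion on a filtered probability space $(\Omega,\mathcal F,\{\mathcal F_t\},\mathbb P)$ (adapted to $\{\mathcal F_t\}$, increments after $t$ independent of $\mathcal F_t$); $\theta<0$, $\sigma>0$, $\gamma:=-2\theta/\sigma^2$; $\underline{\gamma}>0$ is a known constant with $\underline{\gamma}\le\gamma$. Assumption on $h:\mathbb R\to[0,\infty)$: (i) $h$ is continuous; $h$ is strictly increasing on $[0,\infty)$; $h$ is continuously differentiable on $(-\infty,0)$ with $h'(x)<0$ there; (ii) $\lim_{x\to-\infty}h(x)=+\infty$; (iii) there is a constant $0<b<\underline{\gamma}/2$ with $\limsup_{x\to+\infty}h(x)/e^{bx}<+\infty$. Reflected Brownian motion. For $s\ge 0$ and $\mathcal F_s$-measurable (possibly random) $r$ and $y\ge r$, $(Z_r^{s,y},Y_r^{s,y})$ is the unique continuous adapted pair on $[s,\infty)$ with $Z_r^{s,y}(t)=y+\theta(t-s)+\sigma(B(t)-B(s))+Y_r^{s,y}(t)\ge r$, $Y_r^{s,y}$ nondecreasing, $Y_r^{s,y}(s)=0$, $\int_s^t\mathbf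 1_{\{Z_r^{s,y}(u)>r\}}\,dY_r^{s,y}(u)=0$ for $t\ge s$. Write $Z_r:=Z_r^{0,x}$. Cost. $C(u,r):=u\int_r^\infty h(z)e^{-u(z-r)}\,dz$ and $F(u,r):=C(u,r)-h(r)$. For each $u\ge\underline{\gamma}$ the equation $F(u,r)=0$ has a unique solution $r\in\mathbb R$, which is negative; it is denoted $r(u)$. There is $K_h>0$ with $r(u)\in(-K_h,0)$ for all $u\ge\underline{\gamma}$. LTO estimator: $\hat\gamma(\tau):=\max\{(\frac1\tau\int_0^\tau Z_0(t)\,dt)^{-1},\underline{\gamma}\}$, $\tau>0$. AU algorithm. Let $\tau_k:=2^k-1$, $\Delta\tau_k:=2^k$, $k\ge0$. Set $\hat r_0:=0$, $X_0:=x$. Recursively for $k\ge 0$: on $[\tau_k,\tau_{k+1})$ set $Z^{\mathrm{AU}}(t):=Z^{\tau_k,X_k}_{\hat r_k}(t)$; then $\hat\gamma_{k+1}:=\max\{(\frac1{\Delta\tau_k}\int_{\tau_k}^{\tau_{k+1}}(Z^{\mathrm{AU}}(s)-\hat r_k)\,ds)^{-1},\underline{\gamma}\}$, $\hat r_{k+1}:=r(\hat\gamma_{k+1})$, $X_{k+1}:=\max\{Z^{\mathrm{AU}}(\tau_{k+1}-),\hat r_{k+1}\}$. AU-FH algorithm. Same construction with $\tilde r_k,\tilde X_k,Z^{\mathrm{AU\text{-}FH}}$ in place of $\hat r_k,X_k,Z^{\mathrm{AU}}$ (with $\tilde r_0=0$, $\tilde X_0=x$, $\tilde r_{k+1}:=r(\tilde\gamma_{k+1})$),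 but with $\tilde\gamma_{k+1}:=\max\{(\frac1{\tau_{k+1}}\sum_{i=0}^k\int_{\tau_i}^{\tau_{i+1}}(Z^{\mathrm{AU\text{-}FH}}(s)-\tilde r_i)\,ds)^{-1},\underline{\gamma}\}$. *)

theory Defs
  imports "HOL-Probability.Probability"
begin

definition filtered_prob_space :: "'a measure \<Rightarrow> (real \<Rightarrow> 'a measure) \<Rightarrow> bool" where
  "filtered_prob_space M F \<longleftrightarrow>
     prob_space M \<and>
     (\<forall>t\<ge>0. subalgebra M (F t)) \<and>
     (\<forall>s t. 0 \<le> s \<and> s \<le> t \<longrightarrow> subalgebra (F t) (F s))"

definition standard_brownian_motion ::
    "'a measure \<Rightarrow> (real \<Rightarrow> 'a measure) \<Rightarrow> (real \<Rightarrow> 'a \<Rightarrow> real) \<Rightarrow> bool" where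
  "standard_brownian_motion M F B \<longleftrightarrow>
     (\<forall>t\<ge>0. B t \<in> borel_measurable (F t)) \<and>
     (AE \<omega> in M. B 0 \<omega> = 0) \<and>
     (AE \<omega> in M. continuous_on {0..} (\<lambda>t. B t \<omega>)) \<and>
     (\<forall>s t. 0 \<le> s \<and> s < t \<longrightarrow>
        distributed M lborel (\<lambda>\<omega>. B t \<omega> - B s \<omega>) (normal_density 0 (sqrt (t - s)))) \<and>
     (\<forall>s t. 0 \<le> s \<and> s \<le> t \<longrightarrow>
        prob_space.indep_set M (sets (F s))
          (sets (vimage_algebra (space M) (\<lambda>\<omega>. B t \<omega> - B s \<omega>) borel)))"

definition admissible_cost :: "real \<Rightarrow> (real \<Rightarrow> real) \<Rightarrow> bool" where
  "admissible_cost \<gamma>low h \<longleftrightarrow>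
     (\<forall>x. 0 \<le> h x) \<and>
     continuous_on UNIV h \<and>
     strict_mono_on {0..} h \<and>
     (\<forall>x<0. h differentiable (at x)) \<and>
     continuous_on {..<0} (deriv h) \<and>
     (\<forall>x<0. deriv h x < 0) \<and>
     filterlim h at_top at_bot \<and>
     (\<exists>b. 0 < b \<and> b < \<gamma>low / 2 \<and>
        Limsup at_top (\<lambda>x. ereal (h x / exp (b * x))) < \<infinity>)"

definition cost_C :: "(real \<Rightarrow> real) \<Rightarrow> real \<Rightarrow> real \<Rightarrow> real" where
  "cost_C h u r = u * (LINT z:{r..}|lborel. h z * exp (- u * (z - r)))"

definition cost_F :: "(real \<Rightarrow> real) \<Rightarrow> real \<Rightarrow> real \<Rightarrow> real" where
  "cost_F h u r = cost_C h u r - h r"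

definition barrier :: "(real \<Rightarrow> real) \<Rightarrow> real \<Rightarrow> real" where
  "barrier h u = (THE r. cost_F h u r = 0)"

text \<open>
  The pair \<open>(Z, Y)\<close> is the Brownian motion with drift \<open>\<theta>\<close> and volatility \<open>\<sigma>\<close> started at time \<open>s\<close>
  from \<open>y\<close> and reflected at \<open>r\<close>. Only times \<open>t \<ge> s\<close> matter. Since \<open>Y\<close> vanishes at \<open>s\<close>, extending
  it to the left of \<open>s\<close> by its value at \<open>s\<close> yields a continuous nondecreasing function on the
  whole line, whose Stieltjes measure is \<open>dY\<close>. Path properties are required almost surely, so
  the pair is unique up to indistinguishability.
\<close>

definition reflected_bm ::
    "'a measure \<Rightarrow> (real \<Rightarrow> 'a measure) \<Rightarrow> (real \<Rightarrow> 'a \<Rightarrow> real) \<Rightarrow> real \<Rightarrow> real \<Rightarrow>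
     real \<Rightarrow> ('a \<Rightarrow> real) \<Rightarrow> ('a \<Rightarrow> real) \<Rightarrow>
     (real \<Rightarrow> 'a \<Rightarrow> real) \<Rightarrow> (real \<Rightarrow> 'a \<Rightarrow> real) \<Rightarrow> bool" where
  "reflected_bm M F B \<theta> \<sigma> s r y Z Y \<longleftrightarrow>
     r \<in> borel_measurable (F s) \<and> y \<in> borel_measurable (F s) \<and>
     (\<forall>t\<ge>s. Z t \<in> borel_measurable (F t) \<and> Y t \<in> borel_measurable (F t)) \<and>
     (AE \<omega> in M.
        r \<omega> \<le> y \<omega> \<and>
        continuous_on {s..} (\<lambda>t. Z t \<omega>) \<and>
        continuous_on {s..} (\<lambda>t. Y t \<omega>) \<and>
        (\<forall>t\<ge>s. Z t \<omega> = y \<omega> + \<theta> * (t - s) + \<sigma> * (B t \<omega> - B s \<omega>) + Y t \<omega>) \<and>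
        (\<forall>t\<ge>s. r \<omega> \<le> Z t \<omega>) \<and>
        mono_on {s..} (\<lambda>t. Y t \<omega>) \<and>
        Y s \<omega> = 0 \<and>
        (\<forall>t\<ge>s. (\<integral>\<^sup>+ u \<in> {s..t}. indicator {v. r \<omega> < Z v \<omega>} u
                   \<partial>interval_measure (\<lambda>v. Y (max s v) \<omega>)) = 0))"

text \<open>
  In the estimators below a vanishing average has inverse \<open>0\<close> instead of \<open>+\<infinity>\<close>; this happens
  only with probability zero.
\<close>

definition LTO_estimator :: "real \<Rightarrow> (real \<Rightarrow> real) \<Rightarrow> real \<Rightarrow> real" where
  "LTO_estimator \<gamma>low z \<tau> = max (inverse (1 / \<tau> * (LINT t:{0..\<tau>}|lborel. z t))) \<gamma>low"

definition epoch :: "nat \<Rightarrow> real" where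
  "epoch k = 2 ^ k - 1"

definition epoch_len :: "nat \<Rightarrow> real" where
  "epoch_len k = 2 ^ k"

definition AU_estimator :: "real \<Rightarrow> (real \<Rightarrow> real) \<Rightarrow> (nat \<Rightarrow> real) \<Rightarrow> nat \<Rightarrow> real" where
  "AU_estimator \<gamma>low z r k =
     max (inverse (1 / epoch_len k * (LINT s:{epoch k..epoch (Suc k)}|lborel. z s - r k))) \<gamma>low"

definition AUFH_estimator :: "real \<Rightarrow> (real \<Rightarrow> real) \<Rightarrow> (nat \<Rightarrow> real) \<Rightarrow> nat \<Rightarrow> real" where
  "AUFH_estimator \<gamma>low z r k =
     max (inverse (1 / epoch (Suc k) *
            (\<Sum>i=0..k. LINT s:{epoch i..epoch (Suc i)}|lborel. z s - r i))) \<gamma>low"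

text \<open>
  The recursion shared by the two adaptive algorithms. The argument \<open>est\<close> maps the path of the
  controlled process \<open>Z\<close>, the barriers used so far and the index \<open>k\<close> to the estimate computed
  at the end of the \<open>k\<close>-th epoch, which is \<open>g (Suc k)\<close>; the value \<open>g 0\<close> is unconstrained.
\<close>

definition adaptive_run ::
    "((real \<Rightarrow> real) \<Rightarrow> (nat \<Rightarrow> real) \<Rightarrow> nat \<Rightarrow> real) \<Rightarrow>
     'a measure \<Rightarrow> (real \<Rightarrow> 'a measure) \<Rightarrow> (real \<Rightarrow> 'a \<Rightarrow> real) \<Rightarrow> real \<Rightarrow> real \<Rightarrow>
     (real \<Rightarrow> real) \<Rightarrow> real \<Rightarrow>
     (real \<Rightarrow> 'a \<Rightarrow> real) \<Rightarrow> (nat \<Rightarrow> 'a \<Rightarrow> real) \<Rightarrow> (nat \<Rightarrow> 'a \<Rightarrow> real) \<Rightarrow> (nat \<Rightarrow> 'a \<Rightarrow> real) \<Rightarrow> bool" where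
  "adaptive_run est M F B \<theta> \<sigma> h x Z r X g \<longleftrightarrow>
     (AE \<omega> in M. r 0 \<omega> = 0 \<and> X 0 \<omega> = x) \<and>
     (\<forall>k. (\<exists>Zk Yk. reflected_bm M F B \<theta> \<sigma> (epoch k) (r k) (X k) Zk Yk \<and>
              (AE \<omega> in M. \<forall>t\<in>{epoch k..<epoch (Suc k)}. Z t \<omega> = Zk t \<omega>)) \<and>
          (AE \<omega> in M.
             g (Suc k) \<omega> = est (\<lambda>t. Z t \<omega>) (\<lambda>i. r i \<omega>) k \<and>
             r (Suc k) \<omega> = barrier h (g (Suc k) \<omega>) \<and>
             X (Suc k) \<omega> =
               max (Lim (at_left (epoch (Suc k))) (\<lambda>t. Z t \<omega>)) (r (Suc k) \<omega>)))"

definition AU_run where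
  "AU_run \<gamma>low = adaptive_run (AU_estimator \<gamma>low)"

definition AUFH_run where
  "AUFH_run \<gamma>low = adaptive_run (AUFH_estimator \<gamma>low)"

end

theory Submission
  imports Defs
begin

text \<open>
  Put \<open>l t = \<theta> * t + \<sigma> * B t\<close>. In every epoch the distance of the controlled process from its
  barrier is the Skorokhod reflection of \<open>l\<close> at zero, an explicit functional of the path
  (\<open>skorokhod_reflected_path\<close>). Two reflections of the same path never move apart, and they coincide as
  soon as the free path from the higher one has fallen to zero. All three algorithms can therefore be
  compared with the single process \<open>reflect l t = (SUP u\<in>{0..t}. l t - l u)\<close>, and it has to be shown
  that its time average tends to \<open>\<sigma>\<^sup>2 / (- 2 * \<theta>)\<close>, the inverse of \<open>\<gamma>\<close>.

  For this limit (\<open>reflect_mean\<close>), the Ito formula for the square of \<open>W = reflect l\<close>, in which the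
  regulator does not appear because it acts only when \<open>W\<close> is zero, reads
  \<open>- 2 * \<theta> * \<integral>W dt - \<sigma>\<^sup>2 * T = 2 * \<sigma> * \<integral>W dB - (W T)\<^sup>2\<close>. If the moments of \<open>W\<close> are bounded in time,
  the right-hand side has a second moment of order \<open>T\<close>, so the average converges almost surely along
  the squares by Borel-Cantelli, and then along all times by monotonicity of the integral.
  The formula is derived on a grid, where \<open>W\<close> becomes the Lindley recursion
  \<open>V (n + 1) = max 0 (V n + \<xi> n)\<close> and the formula a telescoping sum (\<open>lindley_square\<close>,
  \<open>ito_defect_eq\<close>). Kingman's inequality (\<open>kingman_step\<close>) bounds the tail of \<open>V n\<close> at \<open>x\<close> by
  \<open>exp (- \<gamma> * x)\<close> for every \<open>n\<close> and every mesh size, and Fatou's lemma removes the grid.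

  The same moment bounds, applied to small negative drifts and to both \<open>B\<close> and \<open>- B\<close>, show that
  \<open>B t / t\<close> tends to zero (\<open>B_sublinear\<close>), so \<open>l\<close> has asymptotic slope \<open>\<theta>\<close>. The barriers stay in a
  compact interval (\<open>barrier_bounded\<close>): multiplied by \<open>exp (- u * r)\<close>, the function whose zero is
  sought becomes strictly increasing to the left of zero, and there it is negative as soon as \<open>h r\<close> exceeds
  a constant that does not depend on \<open>u\<close>. Hence the reflected process of each epoch merges with
  \<open>reflect l\<close> within a vanishing fraction of the epoch, and the epoch averages tend to the same limit
  (\<open>epoch_mean_tendsto\<close>). The estimators are truncated inverses of these averages or of their
  length-weighted means.
\<close>


section \<open>Skorokhod reflection of a continuous path\<close>

text \<open>
  Reflection at zero of the path \<open>l\<close> from time \<open>s\<close> on, described without the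
  regulator process: \<open>w\<close> is nonnegative, its increments dominate those of \<open>l\<close>, and it is either
  still free or has been free since a visit to zero at time \<open>u\<close>. Equivalently, \<open>w t\<close> is the
  larger of \<open>w s + (l t - l s)\<close> and the supremum of \<open>l t - l u\<close> over \<open>u \<in> {s..t}\<close>.
\<close>

definition reflected_path :: "(real \<Rightarrow> real) \<Rightarrow> real \<Rightarrow> (real \<Rightarrow> real) \<Rightarrow> bool" where
  "reflected_path l s w \<longleftrightarrow>
     (\<forall>t\<ge>s. 0 \<le> w t \<and> (\<forall>u\<in>{s..t}. w u + (l t - l u) \<le> w t) \<and>
        (w t = w s + (l t - l s) \<or> (\<exists>u\<in>{s..t}. w t = l t - l u)))"

text \<open>
  The flow property. If the last free stretch began before \<open>s'\<close>, the path is still free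
  as seen from \<open>s'\<close>, because the domination of increments leaves no room on either side.
\<close>

lemma reflected_path_restart:
  assumes w: "reflected_path l s w" and "s \<le> s'"
  shows "reflected_path l s' w"
  unfolding reflected_path_def
proof (intro allI impI)
  fix t assume t: "s' \<le> t"
  then have st: "s \<le> t" using assms by simp
  have mon: "w u + (l v - l u) \<le> w v" if "s \<le> u" "u \<le> v" for u v
    using w that unfolding reflected_path_def by (meson atLeastAtMost_iff order_trans)
  have nn: "0 \<le> w v" if "s \<le> v" for v
    using w that unfolding reflected_path_def by blast
  have "w t = w s' + (l t - l s') \<or> (\<exists>u\<in>{s'..t}. w t = l t - l u)"
  proof -
    have "w t = w s + (l t - l s) \<or> (\<exists>u\<in>{s..t}. w t = l t - l u)"
      using w st unfolding reflected_path_def by blast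
    then consider "w t = w s + (l t - l s)" | u where "u \<in> {s..t}" "w t = l t - l u" by blast
    then show ?thesis
    proof cases
      case 1
      then show ?thesis using mon[of s s'] mon[of s' t] assms t by force
    next
      case 2
      show ?thesis
      proof (cases "s' \<le> u")
        case True then show ?thesis using 2 by auto
      next
        case False
        then show ?thesis using 2 mon[of u s'] mon[of s' t] nn[of u] t by force
      qed
    qed
  qed
  then show "0 \<le> w t \<and> (\<forall>u\<in>{s'..t}. w u + (l t - l u) \<le> w t) \<and>
        (w t = w s' + (l t - l s') \<or> (\<exists>u\<in>{s'..t}. w t = l t - l u))"
    using mon nn st assms(2) by auto
qed

text \<open>
  Both paths are driven by the same \<open>l\<close>. While \<open>w\<close> is free, \<open>w'\<close> rises at least as much;
  and once \<open>w\<close> has visited zero, it lies below every reflected path.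
\<close>

lemma reflected_path_diff_le:
  assumes w: "reflected_path l s w" and w': "reflected_path l s w'" and "s \<le> t"
  shows "w t - w' t \<le> max 0 (w s - w' s)"
proof -
  have mon: "w' u + (l t - l u) \<le> w' t" if "s \<le> u" "u \<le> t" for u
    using w' that unfolding reflected_path_def by (meson atLeastAtMost_iff order_trans)
  have nn: "0 \<le> w' v" if "s \<le> v" for v
    using w' that unfolding reflected_path_def by blast
  have "w t = w s + (l t - l s) \<or> (\<exists>u\<in>{s..t}. w t = l t - l u)"
    using w \<open>s \<le> t\<close> unfolding reflected_path_def by blast
  then show ?thesis using mon[of s] mon nn \<open>s \<le> t\<close> by fastforce
qed

lemma reflected_path_abs_diff_le:
  assumes "reflected_path l s w" "reflected_path l s w'" "s \<le> t"
  shows "\<bar>w t - w' t\<bar> \<le> \<bar>w s - w' s\<bar>"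
  using reflected_path_diff_le[OF assms] reflected_path_diff_le[OF assms(2,1,3)] by linarith

text \<open>
  The condition says that the free path from \<open>w s\<close> is no longer positive at time \<open>t\<close>, so
  \<open>w\<close> has visited zero by then. Used in both directions, this shows that two
  reflected paths have merged.
\<close>

lemma reflected_path_le_after_zero:
  assumes w: "reflected_path l s w" and w': "reflected_path l s w'" and "s \<le> t"
    and "w s + (l t - l s) \<le> 0"
  shows "w t \<le> w' t"
proof -
  have mon: "w' u + (l t - l u) \<le> w' t" if "s \<le> u" "u \<le> t" for u
    using w' that unfolding reflected_path_def by (meson atLeastAtMost_iff order_trans)
  have nn: "0 \<le> w' v" if "s \<le> v" for v
    using w' that unfolding reflected_path_def by blast
  have "w t = w s + (l t - l s) \<or> (\<exists>u\<in>{s..t}. w t = l t - l u)"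
    using w \<open>s \<le> t\<close> unfolding reflected_path_def by blast
  then show ?thesis using mon[of s] mon nn[of t] nn \<open>s \<le> t\<close> assms(4) by fastforce
qed

text \<open>
  Uniqueness in the Skorokhod problem. The regulator \<open>Y\<close> is constant on any interval on
  which \<open>Z\<close> stays above the barrier, so between the last visit to the barrier and \<open>t\<close> the increment
  of \<open>Z\<close> is that of \<open>l\<close>.
\<close>

lemma skorokhod_reflected_path:
  fixes Z Y l :: "real \<Rightarrow> real"
  assumes Z: "continuous_on {s..} Z" and Y: "continuous_on {s..} Y"
    and eq: "\<And>t. s \<le> t \<Longrightarrow> Z t = y + (l t - l s) + Y t"
    and ge: "\<And>t. s \<le> t \<Longrightarrow> r \<le> Z t"
    and mono: "mono_on {s..} Y" and Ys: "Y s = 0"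
    and flat: "\<And>t. s \<le> t \<Longrightarrow> (\<integral>\<^sup>+ u \<in> {s..t}. indicator {v. r < Z v} u
                   \<partial>interval_measure (\<lambda>v. Y (max s v))) = 0"
  shows "reflected_path l s (\<lambda>t. Z t - r)"
  unfolding reflected_path_def
proof (intro allI impI conjI ballI)
  fix t assume t: "s \<le> t"
  show "0 \<le> Z t - r" using ge[OF t] by simp
  show "Z u - r + (l t - l u) \<le> Z t - r" if "u \<in> {s..t}" for u
    using eq[of u] eq[of t] mono_onD[OF mono, of u t] that by auto
  have const: "Y t = Y u" if u: "s \<le> u" "u \<le> t" and pos: "\<And>v. u < v \<Longrightarrow> v \<le> t \<Longrightarrow> r < Z v" for u
  proof -
    let ?F = "\<lambda>v. Y (max s v)"
    let ?I = "interval_measure ?F"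
    have "continuous_on UNIV ?F"
      by (rule continuous_on_compose2[OF Y]) (auto intro!: continuous_intros)
    then have cont: "continuous (at_right a) ?F" for a
      by (simp add: continuous_on_eq_continuous_within continuous_at_imp_continuous_at_within)
    have monoF: "?F a \<le> ?F b" if "a \<le> b" for a b
      using mono_onD[OF mono, of "max s a" "max s b"] that by auto
    have "ennreal (?F t - ?F u) = emeasure ?I {u<..t}"
      by (rule emeasure_interval_measure_Ioc[symmetric]) (use u monoF cont in auto)
    also have "\<dots> = (\<integral>\<^sup>+v. indicator {u<..t} v \<partial>?I)"
      by simp
    also have "\<dots> \<le> (\<integral>\<^sup>+ v \<in> {s..t}. indicator {v. r < Z v} v \<partial>?I)"
      by (rule nn_integral_mono) (use u pos in \<open>auto split: split_indicator\<close>)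
    also have "\<dots> = 0" using flat[OF t] .
    finally have "?F t - ?F u \<le> 0" by (simp add: ennreal_eq_0_iff)
    then show ?thesis using u mono_onD[OF mono, of u t] by auto
  qed
  show "Z t - r = Z s - r + (l t - l s) \<or> (\<exists>u\<in>{s..t}. Z t - r = l t - l u)"
  proof (cases "\<exists>v\<in>{s..t}. Z v = r")
    case False
    then have "Y t = Y s" using ge t by (intro const) (auto simp: less_le)
    then show ?thesis using eq[of t] eq[of s] t by auto
  next
    case True
    define A where "A = {s..t} \<inter> Z -` {r}"
    have "continuous_on {s..t} Z" using Z by (rule continuous_on_subset) auto
    then have "closed A" unfolding A_def by (intro continuous_closed_preimage) auto
    moreover have "A \<noteq> {}" using True unfolding A_def by auto
    moreover have bdd: "bdd_above A" unfolding A_def by (auto intro: bdd_aboveI[of _ t])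
    ultimately have "Sup A \<in> A" by (intro closed_contains_Sup) auto
    then have S: "s \<le> Sup A" "Sup A \<le> t" "Z (Sup A) = r" unfolding A_def by auto
    have "Y t = Y (Sup A)"
    proof (rule const)
      fix v assume v: "Sup A < v" "v \<le> t"
      then have "v \<notin> A" using cSup_upper[OF _ bdd, of v] by force
      then show "r < Z v" using v S ge[of v] unfolding A_def by force
    qed (use S in auto)
    then show ?thesis using eq[of t] eq[of "Sup A"] S t by force
  qed
qed

text \<open>
  The reflection of \<open>l\<close> at zero started from zero at time zero. It is the reference
  process with which all processes of the three algorithms are compared.
\<close>

definition reflect :: "(real \<Rightarrow> real) \<Rightarrow> real \<Rightarrow> real" where
  "reflect l t = (SUP u\<in>{0..t}. l t - l u)"

context
  fixes l :: "real \<Rightarrow> real"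
  assumes cont: "continuous_on {0..} l"
begin

lemma
  assumes "0 \<le> t"
  shows reflect_attained: "\<exists>u\<in>{0..t}. reflect l t = l t - l u"
    and reflect_ge: "\<And>u. 0 \<le> u \<Longrightarrow> u \<le> t \<Longrightarrow> l t - l u \<le> reflect l t"
proof -
  have "continuous_on {0..t} (\<lambda>u. l t - l u)"
    by (intro continuous_intros continuous_on_subset[OF cont]) auto
  then obtain u where u: "u \<in> {0..t}" "\<And>v. v \<in> {0..t} \<Longrightarrow> l t - l v \<le> l t - l u"
    using continuous_attains_sup[of "{0..t}" "\<lambda>u. l t - l u"] assms by auto
  then have "reflect l t = l t - l u"
    unfolding reflect_def by (intro cSup_eq_maximum) auto
  with u show "\<exists>u\<in>{0..t}. reflect l t = l t - l u"
    "\<And>u. 0 \<le> u \<Longrightarrow> u \<le> t \<Longrightarrow> l t - l u \<le> reflect l t" by auto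
qed

lemma reflect_nonneg: "0 \<le> t \<Longrightarrow> 0 \<le> reflect l t"
  using reflect_ge[of t t] by simp

lemma reflect_step:
  assumes "0 \<le> s" "s \<le> t" shows "reflect l s + (l t - l s) \<le> reflect l t"
  using reflect_attained[of s] reflect_ge[of t] assms by fastforce

lemma reflected_path_reflect: "reflected_path l 0 (reflect l)"
  unfolding reflected_path_def using reflect_nonneg reflect_step reflect_attained by auto

text \<open>
  If \<open>u\<close> attains the supremum at \<open>t\<close>, then \<open>min u s\<close> is an almost optimal choice at \<open>s\<close>.
\<close>

lemma reflect_near:
  assumes st: "0 \<le> s" "0 \<le> t"
    and osc: "\<And>u v. 0 \<le> u \<Longrightarrow> 0 \<le> v \<Longrightarrow> u \<le> max s t \<Longrightarrow> v \<le> max s t \<Longrightarrow> \<bar>u - v\<bar> \<le> \<bar>s - t\<bar> \<Longrightarrow> \<bar>l u - l v\<bar> \<le> e"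
  shows "\<bar>reflect l s - reflect l t\<bar> \<le> 2 * e"
proof -
  have aux: "reflect l t \<le> reflect l s + 2 * e" if st: "0 \<le> s" "0 \<le> t"
    and osc: "\<And>u v. 0 \<le> u \<Longrightarrow> 0 \<le> v \<Longrightarrow> u \<le> max s t \<Longrightarrow> v \<le> max s t \<Longrightarrow> \<bar>u - v\<bar> \<le> \<bar>s - t\<bar> \<Longrightarrow> \<bar>l u - l v\<bar> \<le> e" for s t
  proof -
    obtain u where u: "0 \<le> u" "u \<le> t" "reflect l t = l t - l u" using reflect_attained[of t] st by auto
    have "\<bar>l t - l s\<bar> \<le> e" by (intro osc) (use st in auto)
    moreover have "\<bar>l u - l (min u s)\<bar> \<le> e" by (intro osc) (use u st in auto)
    moreover have "l s - l (min u s) \<le> reflect l s" using u st by (intro reflect_ge) auto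
    ultimately show ?thesis using u by linarith
  qed
  have "reflect l t \<le> reflect l s + 2 * e" by (rule aux) (use st osc in auto)
  moreover have "reflect l s \<le> reflect l t + 2 * e"
    by (rule aux) (use st osc in \<open>auto simp: max.commute abs_minus_commute\<close>)
  ultimately show ?thesis by linarith
qed

lemma oscillation_le_nearby:
  assumes "0 < (e::real)"
  obtains d where "0 < d" "\<And>u v. 0 \<le> u \<Longrightarrow> u \<le> T \<Longrightarrow> 0 \<le> v \<Longrightarrow> v \<le> T \<Longrightarrow> \<bar>u - v\<bar> < d \<Longrightarrow> \<bar>l u - l v\<bar> \<le> e"
proof -
  have "uniformly_continuous_on {0..T} l"
    by (intro compact_uniformly_continuous continuous_on_subset[OF cont]) auto
  then obtain d where "0 < d" "\<forall>x\<in>{0..T}. \<forall>x'\<in>{0..T}. dist x' x < d \<longrightarrow> dist (l x') (l x) < e"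
    using assms unfolding uniformly_continuous_on_def by metis
  then show ?thesis using that[of d] by (fastforce simp: dist_real_def)
qed

lemma continuous_on_reflect: "continuous_on {0..} (reflect l)"
proof -
  have "\<exists>d>0. \<forall>t\<in>{0..}. dist t s < d \<longrightarrow> dist (reflect l t) (reflect l s) < e"
    if e: "0 < e" and s: "0 \<le> s" for e s :: real
  proof -
    obtain d where d: "0 < d" "\<And>u v. 0 \<le> u \<Longrightarrow> u \<le> s + 1 \<Longrightarrow> 0 \<le> v \<Longrightarrow> v \<le> s + 1 \<Longrightarrow> \<bar>u - v\<bar> < d \<Longrightarrow> \<bar>l u - l v\<bar> \<le> e / 3"
      using oscillation_le_nearby[of "e/3" "s+1"] e by auto
    show ?thesis
    proof (intro exI[of _ "min d 1"] conjI ballI impI)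
      fix t assume t: "t \<in> {0..}" "dist t s < min d 1"
      have "\<bar>reflect l t - reflect l s\<bar> \<le> 2 * (e/3)"
      proof (rule reflect_near)
        fix u v :: real
        assume "0 \<le> u" "0 \<le> v" "u \<le> max t s" "v \<le> max t s" "\<bar>u - v\<bar> \<le> \<bar>t - s\<bar>"
        then show "\<bar>l u - l v\<bar> \<le> e / 3" using t s by (intro d) (auto simp: dist_real_def)
      qed (use t s in auto)
      then show "dist (reflect l t) (reflect l s) < e" using e by (simp add: dist_real_def)
    qed (use d in auto)
  qed
  then show ?thesis unfolding continuous_on_iff by auto
qed

end


section \<open>The Lindley recursion on a grid\<close>

text \<open>
  The reflected random walk with increments \<open>a\<close> (the waiting times of a queue).
\<close>

primrec lindley :: "(nat \<Rightarrow> real) \<Rightarrow> nat \<Rightarrow> real" where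
  "lindley a 0 = 0"
| "lindley a (Suc n) = max 0 (lindley a n + a n)"

text \<open>
  The amount by which step \<open>n\<close> is corrected: the increment of the discrete regulator.
\<close>

definition lindley_push :: "(nat \<Rightarrow> real) \<Rightarrow> nat \<Rightarrow> real" where
  "lindley_push a n = max 0 (- (lindley a n + a n))"

lemma lindley_nonneg: "0 \<le> lindley a n"
  by (cases n) auto

lemma lindley_push_le: "lindley_push a n \<le> \<bar>a n\<bar>"
  using lindley_nonneg[of a n] by (auto simp: lindley_push_def)

lemma lindley_push_nonneg: "0 \<le> lindley_push a n"
  by (auto simp: lindley_push_def)

lemma sum_lindley_push: "(\<Sum>n<N. lindley_push a n) = lindley a N - (\<Sum>n<N. a n)"
  by (induction N) (auto simp: lindley_push_def)

text \<open>
  A discrete Ito formula. Since \<open>lindley a (Suc n)\<close> or \<open>lindley_push a n\<close> is zero, a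
  correction enters the square only through its own square.
\<close>

lemma lindley_square:
  "(lindley a N)\<^sup>2 = (\<Sum>n<N. 2 * lindley a n * a n + (a n)\<^sup>2 - (lindley_push a n)\<^sup>2)"
proof (induction N)
  case (Suc N)
  let ?s = "lindley a N + a N"
  have "(lindley a (Suc N))\<^sup>2 = ?s\<^sup>2 - (lindley_push a N)\<^sup>2"
    by (auto simp: lindley_push_def max_def power2_eq_square algebra_simps)
  also have "\<dots> = (lindley a N)\<^sup>2 + (2 * lindley a N * a N + (a N)\<^sup>2 - (lindley_push a N)\<^sup>2)"
    by (simp add: power2_eq_square algebra_simps)
  finally show ?case using Suc by simp
qed simp

definition grid_inc :: "(real \<Rightarrow> real) \<Rightarrow> real \<Rightarrow> nat \<Rightarrow> nat \<Rightarrow> real" where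
  "grid_inc l T N n = l (T * real (Suc n) / real N) - l (T * real n / real N)"

lemma sum_grid_inc:
  "(\<Sum>n<m. grid_inc l T N n) = l (T * real m / real N) - l 0"
  using sum_lessThan_telescope[of "\<lambda>n. l (T * real n / real N)" m] by (simp add: grid_inc_def)

lemma lindley_grid_ge:
  "k \<le> n \<Longrightarrow> l (T * real n / real N) - l (T * real k / real N) \<le> lindley (grid_inc l T N) n"
proof (induction n)
  case (Suc n)
  show ?case
  proof (cases "k = Suc n")
    case False
    then have "k \<le> n" using Suc by simp
    with Suc.IH show ?thesis by (auto simp: grid_inc_def)
  qed auto
qed simp

lemma integral_grid_approx:
  fixes f :: "real \<Rightarrow> real"
  assumes f: "continuous_on {0..T} f" and T: "0 \<le> T" and N: "0 < N"
    and near: "\<And>n t. n < N \<Longrightarrow> T * real n / real N \<le> t \<Longrightarrow> t \<le> T * real (Suc n) / real N \<Longrightarrow> \<bar>f t - c n\<bar> \<le> e"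
  shows "\<bar>integral {0..T} f - T / N * (\<Sum>n<N. c n)\<bar> \<le> e * T"
proof -
  define p where "p n = T * real n / real N" for n
  have p: "0 \<le> p n" "p n \<le> p (Suc n)" "p (Suc n) - p n = T / N" for n
    using T N by (auto simp: p_def divide_simps algebra_simps)
  have pT: "p n \<le> T" if "n \<le> N" for n
    using T N that by (auto simp: p_def divide_simps intro: mult_left_mono)
  have "n \<le> N \<Longrightarrow> \<bar>integral {0..p n} f - T / N * (\<Sum>k<n. c k)\<bar> \<le> e * p n" for n
  proof (induction n)
    case (Suc n)
    have int: "f integrable_on {0..p (Suc n)}" "f integrable_on {p n..p (Suc n)}"
      using pT[of "Suc n"] p(1)[of n] Suc.prems
      by (auto intro!: integrable_continuous_interval continuous_on_subset[OF f])
    have split: "integral {0..p n} f + integral {p n..p (Suc n)} f = integral {0..p (Suc n)} f"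
      by (rule Henstock_Kurzweil_Integration.integral_combine) (use p int in auto)
    have const: "integral {p n..p (Suc n)} (\<lambda>_. c n) = T / N * c n"
      using p[of n] by simp
    have "integral {p n..p (Suc n)} f - T / N * c n = integral {p n..p (Suc n)} (\<lambda>t. f t - c n)"
      using int const by (subst Henstock_Kurzweil_Integration.integral_diff) auto
    moreover have "norm (integral {p n..p (Suc n)} (\<lambda>t. f t - c n)) \<le> e * (p (Suc n) - p n)"
    proof (rule integral_bound)
      show "continuous_on {p n..p (Suc n)} (\<lambda>t. f t - c n)"
        using pT[of "Suc n"] p(1)[of n] Suc.prems
        by (auto intro!: continuous_intros continuous_on_subset[OF f])
      show "norm (f t - c n) \<le> e" if "t \<in> {p n..p (Suc n)}" for t
        using near[of n t] that Suc.prems by (auto simp: p_def)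
    qed (use p in auto)
    ultimately have "\<bar>integral {p n..p (Suc n)} f - T / N * c n\<bar> \<le> e * (p (Suc n) - p n)" by simp
    moreover have "\<bar>integral {0..p n} f - T / N * (\<Sum>k<n. c k)\<bar> \<le> e * p n" using Suc by simp
    moreover have "T / N * (\<Sum>k<Suc n. c k) = T / N * (\<Sum>k<n. c k) + T / N * c n"
      by (simp add: algebra_simps)
    moreover have "e * (p (Suc n) - p n) = e * p (Suc n) - e * p n" by (rule right_diff_distrib)
    ultimately show ?case using split by linarith
  qed (simp add: p_def)
  from this[of N] show ?thesis using N by (simp add: p_def)
qed

context
  fixes l :: "real \<Rightarrow> real" and T :: real
  assumes cont: "continuous_on {0..} l" and T: "0 < T"
begin

lemma lindley_grid_le: "lindley (grid_inc l T N) n \<le> reflect l (T * real n / real N)"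
proof (induction n)
  case (Suc n)
  have "T * real n / real N \<le> T * real (Suc n) / real N" "0 \<le> T * real n / real N"
    using T by (auto simp: divide_right_mono)
  from reflect_step[OF cont this(2,1)] reflect_nonneg[OF cont, of "T * real (Suc n) / real N"] this Suc
  show ?case using T by (auto simp: grid_inc_def)
qed (simp add: reflect_nonneg[OF cont])

text \<open>
  Replacing the time at which the supremum in \<open>reflect\<close> is attained by the grid point on its
  left, and \<open>t\<close> by \<open>T * n / N\<close>, costs one oscillation of \<open>l\<close> each.
\<close>

lemma lindley_grid_near:
  assumes N: "0 < N"
    and osc: "\<And>u v. 0 \<le> u \<Longrightarrow> u \<le> T \<Longrightarrow> 0 \<le> v \<Longrightarrow> v \<le> T \<Longrightarrow> \<bar>u - v\<bar> \<le> T / N \<Longrightarrow> \<bar>l u - l v\<bar> \<le> e"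
    and t: "T * real n / real N \<le> t" "t \<le> T * real (Suc n) / real N" "t \<le> T"
  shows "\<bar>reflect l t - lindley (grid_inc l T N) n\<bar> \<le> 2 * e"
proof -
  define p where "p n = T * real n / real N" for n
  have p: "0 \<le> p n" "p n \<le> p (Suc n)" "p (Suc n) - p n = T / N" for n
    using T N by (auto simp: p_def divide_simps algebra_simps)
  have pt: "p n \<le> t" "t \<le> p (Suc n)" using t by (auto simp: p_def)
  have t0: "0 \<le> t" using pt(1) p(1)[of n] by linarith
  have e0: "0 \<le> e" using osc[of 0 0] T N by simp
  have close: "\<bar>l t - l (p n)\<bar> \<le> e"
    by (rule osc) (use t t0 pt p[of n] in auto)
  obtain u where u: "0 \<le> u" "u \<le> t" "reflect l t = l t - l u"
    using reflect_attained[OF cont t0] by auto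
  have "\<exists>k\<le>n. p k \<le> u \<and> u \<le> p (Suc k)"
  proof -
    define k where "k = nat \<lfloor>u * N / T\<rfloor>"
    have k: "real k \<le> u * N / T" "u * N / T < real k + 1"
      using u T N unfolding k_def by (auto simp: of_nat_nat)
    show ?thesis
    proof (cases "k \<le> n")
      case True
      then show ?thesis using k T N by (intro exI[of _ k]) (auto simp: p_def divide_simps algebra_simps)
    next
      case False
      have "p (Suc n) \<le> p k" using False T N by (auto simp: p_def divide_simps)
      also have "\<dots> \<le> u" using k T N by (auto simp: p_def divide_simps algebra_simps)
      finally show ?thesis using u pt p(2)[of n] by (intro exI[of _ n]) auto
    qed
  qed
  then obtain k where k: "k \<le> n" "p k \<le> u" "u \<le> p (Suc k)" by blast
  have "\<bar>l u - l (p k)\<bar> \<le> e"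
    by (rule osc) (use u k p[of k] t in auto)
  moreover have "l (p n) - l (p k) \<le> lindley (grid_inc l T N) n"
    using lindley_grid_ge[OF k(1)] by (simp add: p_def)
  moreover have "lindley (grid_inc l T N) n + (l t - l (p n)) \<le> reflect l t"
    using lindley_grid_le[of N n] reflect_step[OF cont p(1)[of n] pt(1)] by (simp add: p_def)
  ultimately show ?thesis using u close e0 by linarith
qed

lemma eventually_grid_osc:
  assumes "0 < e"
  shows "\<forall>\<^sub>F N in sequentially. 0 < N \<and>
    (\<forall>u v. 0 \<le> u \<longrightarrow> u \<le> T \<longrightarrow> 0 \<le> v \<longrightarrow> v \<le> T \<longrightarrow> \<bar>u - v\<bar> \<le> T / N \<longrightarrow> \<bar>l u - l v\<bar> \<le> e)"
proof -
  obtain d where d: "0 < d" "\<And>u v. 0 \<le> u \<Longrightarrow> u \<le> T \<Longrightarrow> 0 \<le> v \<Longrightarrow> v \<le> T \<Longrightarrow> \<bar>u - v\<bar> < d \<Longrightarrow> \<bar>l u - l v\<bar> \<le> e"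
    using oscillation_le_nearby[OF cont assms, of T] by auto
  have "(\<lambda>N. T / real N) \<longlonglongrightarrow> 0" by (intro real_tendsto_divide_at_top filterlim_real_sequentially) auto
  then have "\<forall>\<^sub>F N in sequentially. T / real N < d" using d by (auto dest: order_tendstoD)
  with eventually_gt_at_top[of "0::nat"] show ?thesis
    by eventually_elim (auto intro!: d(2))
qed

lemma lindley_grid_tendsto: "(\<lambda>N. lindley (grid_inc l T N) N) \<longlonglongrightarrow> reflect l T"
proof (rule tendstoI)
  fix e :: real assume e: "0 < e"
  show "\<forall>\<^sub>F N in sequentially. dist (lindley (grid_inc l T N) N) (reflect l T) < e"
    using eventually_grid_osc[of "e/3", simplified, OF e]
  proof eventually_elim
    case (elim N)
    have "\<bar>reflect l T - lindley (grid_inc l T N) N\<bar> \<le> 2 * (e / 3)"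
      by (rule lindley_grid_near) (use elim T in \<open>auto simp: divide_simps\<close>)
    then show ?case using e unfolding dist_real_def by linarith
  qed
qed

lemma lindley_riemann_tendsto:
  "(\<lambda>N. T / N * (\<Sum>n<N. lindley (grid_inc l T N) n)) \<longlonglongrightarrow> integral {0..T} (reflect l)"
proof (rule tendstoI)
  fix e :: real assume e: "0 < e"
  define d where "d = e / (3 * T)"
  have d: "0 < d" using e T by (simp add: d_def)
  show "\<forall>\<^sub>F N in sequentially. dist (T / N * (\<Sum>n<N. lindley (grid_inc l T N) n)) (integral {0..T} (reflect l)) < e"
    using eventually_grid_osc[OF d]
  proof eventually_elim
    case (elim N)
    have "\<bar>integral {0..T} (reflect l) - T / N * (\<Sum>n<N. lindley (grid_inc l T N) n)\<bar> \<le> 2 * d * T"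
    proof (rule integral_grid_approx)
      show "continuous_on {0..T} (reflect l)"
        by (rule continuous_on_subset[OF continuous_on_reflect[OF cont]]) auto
      fix n t assume n: "n < N" "T * real n / real N \<le> t" "t \<le> T * real (Suc n) / real N"
      have "T * real (Suc n) / real N \<le> T" using n T by (auto simp: divide_simps)
      then show "\<bar>reflect l t - lindley (grid_inc l T N) n\<bar> \<le> 2 * d"
        by (intro lindley_grid_near) (use elim n in auto)
    qed (use T elim in auto)
    also have "2 * d * T < e" using e T by (simp add: d_def)
    finally show ?case by (simp add: dist_real_def abs_minus_commute)
  qed
qed

text \<open>
  Each push is at most the oscillation of \<open>l\<close> over one mesh interval, while the sum of all
  pushes is bounded by the regulator of \<open>reflect l\<close> at time \<open>T\<close>. This is why reflection leaves no
  trace in the limiting Ito formula.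
\<close>

lemma lindley_push_square_tendsto:
  "(\<lambda>N. \<Sum>n<N. (lindley_push (grid_inc l T N) n)\<^sup>2) \<longlonglongrightarrow> 0"
proof (rule tendstoI)
  fix e :: real assume e: "0 < e"
  define C where "C = reflect l T - l T + l 0"
  have C: "0 \<le> C" using reflect_ge[OF cont, of T 0] T by (simp add: C_def)
  define d where "d = e / (C + 1)"
  have d: "0 < d" using e C by (simp add: d_def)
  show "\<forall>\<^sub>F N in sequentially. dist (\<Sum>n<N. (lindley_push (grid_inc l T N) n)\<^sup>2) 0 < e"
    using eventually_grid_osc[OF d]
  proof eventually_elim
    case (elim N)
    let ?D = "lindley_push (grid_inc l T N)"
    have "(\<Sum>n<N. (?D n)\<^sup>2) \<le> (\<Sum>n<N. d * ?D n)"
    proof (rule sum_mono)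
      fix n assume n: "n \<in> {..<N}"
      have "\<bar>grid_inc l T N n\<bar> \<le> d"
      proof -
        have "T * real (Suc n) \<le> T * real N" using n T by (intro mult_left_mono) auto
        then show ?thesis using n T elim unfolding grid_inc_def
          by (intro elim[THEN conjunct2, rule_format]) (auto simp: divide_simps algebra_simps)
      qed
      then have "?D n \<le> d" using lindley_push_le[of "grid_inc l T N" n] by linarith
      then show "(?D n)\<^sup>2 \<le> d * ?D n"
        by (simp add: power2_eq_square mult_right_mono lindley_push_nonneg)
    qed
    also have "\<dots> = d * (lindley (grid_inc l T N) N - (l T - l 0))"
      using elim by (simp add: sum_distrib_left[symmetric] sum_lindley_push sum_grid_inc)
    also have "\<dots> \<le> d * C"
      using lindley_grid_le[of N N] d elim by (intro mult_left_mono) (auto simp: C_def)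
    also have "\<dots> < e" using e C by (simp add: d_def field_simps)
    finally show ?case by (simp add: sum_nonneg)
  qed
qed

end


section \<open>Kingman tail bound\<close>

lemma fourth_power_exp_bound:
  fixes c y :: real
  assumes "0 < c" "0 \<le> y"
  shows "y ^ 4 \<le> (4 / c) ^ 4 * exp (c * y)"
proof -
  have "c * y / 4 \<le> exp (c * y / 4)"
    using exp_ge_add_one_self[of "c * y / 4"] by linarith
  then have "(c * y / 4) ^ 4 \<le> exp (c * y / 4) ^ 4"
    using assms by (intro power_mono) auto
  also have "\<dots> = exp (c * y)" by (simp add: exp_of_nat_mult[symmetric])
  finally have "(4 / c) ^ 4 * (c * y / 4) ^ 4 \<le> (4 / c) ^ 4 * exp (c * y)"
    by (intro mult_left_mono) auto
  moreover have "(4 / c) ^ 4 * (c * y / 4) ^ 4 = y ^ 4"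
    using assms by (simp add: power_mult_distrib[symmetric])
  ultimately show ?thesis by simp
qed

text \<open>
  A bound for the fourth moment of a nonnegative variable whose tail at \<open>x\<close> is at most
  \<open>exp (- c * x)\<close>, obtained by rounding the variable up to an integer.
\<close>

definition exp_tail_moment4 :: "real \<Rightarrow> real" where
  "exp_tail_moment4 c = (\<Sum>k. (real k + 1) ^ 4 * exp (- c * real k))"

lemma summable_exp_tail_moment4:
  assumes "0 < c"
  shows "summable (\<lambda>k. (real k + 1) ^ 4 * exp (- c * real k))"
proof (rule summable_comparison_test)
  show "summable (\<lambda>k. (8 / c) ^ 4 * exp (c / 2) * exp (- c / 2) ^ k)"
    using assms by (intro summable_mult summable_geometric) auto
  have "(real k + 1) ^ 4 * exp (- c * k) \<le> (8 / c) ^ 4 * exp (c / 2) * exp (- c / 2) ^ k" for k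
  proof -
    have "(real k + 1) ^ 4 * exp (- c * k) \<le> ((8 / c) ^ 4 * exp (c / 2 * (real k + 1))) * exp (- c * k)"
      using fourth_power_exp_bound[of "c/2" "real k + 1"] assms by (intro mult_right_mono) auto
    also have "\<dots> = (8 / c) ^ 4 * exp (c / 2) * exp (- c / 2) ^ k"
      by (simp add: exp_of_nat_mult[symmetric] mult.assoc exp_add[symmetric] field_simps)
    finally show ?thesis .
  qed
  then show "\<exists>N. \<forall>n\<ge>N. norm ((real n + 1) ^ 4 * exp (- c * real n)) \<le> (8 / c) ^ 4 * exp (c / 2) * exp (- c / 2) ^ n"
    by auto
qed

lemma exp_tail_moment4_nonneg: "0 < c \<Longrightarrow> 0 \<le> exp_tail_moment4 c"
  unfolding exp_tail_moment4_def by (intro suminf_nonneg summable_exp_tail_moment4) auto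

lemma (in prob_space) moment4_of_exp_tail:
  fixes X :: "'a \<Rightarrow> real"
  assumes X[measurable]: "X \<in> borel_measurable M" and nn: "\<And>\<omega>. 0 \<le> X \<omega>" and c: "0 < c"
    and tail: "\<And>x. 0 \<le> x \<Longrightarrow> emeasure M {\<omega> \<in> space M. x < X \<omega>} \<le> ennreal (exp (- c * x))"
  shows "(\<integral>\<^sup>+\<omega>. ennreal (X \<omega> ^ 4) \<partial>M) \<le> ennreal (exp_tail_moment4 c)"
proof -
  let ?I = "\<lambda>k \<omega>. ennreal ((real k + 1) ^ 4) * indicator {\<omega> \<in> space M. real k < X \<omega>} \<omega>"
  have "(\<integral>\<^sup>+\<omega>. ennreal (X \<omega> ^ 4) \<partial>M) \<le> (\<integral>\<^sup>+\<omega>. (\<Sum>k. ?I k \<omega>) \<partial>M)"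
  proof (rule nn_integral_mono)
    fix \<omega> assume \<omega>: "\<omega> \<in> space M"
    show "ennreal (X \<omega> ^ 4) \<le> (\<Sum>k. ?I k \<omega>)"
    proof (cases "X \<omega> = 0")
      case False
      then have pos: "0 < X \<omega>" using nn[of \<omega>] by simp
      \<comment> \<open>\<open>j\<close> is the largest integer strictly below \<open>X \<omega>\<close>; its term alone dominates.\<close>
      define j where "j = nat (\<lceil>X \<omega>\<rceil> - 1)"
      have j: "real j < X \<omega>" "X \<omega> \<le> real j + 1" using pos unfolding j_def by linarith+
      have "ennreal (X \<omega> ^ 4) \<le> ennreal ((real j + 1) ^ 4)"
        using j pos by (intro ennreal_leI power_mono) auto
      also have "\<dots> = (\<Sum>k\<in>{j}. ?I k \<omega>)" using \<omega> j by simp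
      also have "\<dots> \<le> (\<Sum>k. ?I k \<omega>)" by (intro sum_le_suminf) auto
      finally show ?thesis .
    qed simp
  qed
  also have "\<dots> = (\<Sum>k. \<integral>\<^sup>+\<omega>. ?I k \<omega> \<partial>M)" by (rule nn_integral_suminf) measurable
  also have "\<dots> = (\<Sum>k. ennreal ((real k + 1) ^ 4) * emeasure M {\<omega> \<in> space M. real k < X \<omega>})"
    by (intro suminf_cong nn_integral_cmult_indicator) measurable
  also have "\<dots> \<le> (\<Sum>k. ennreal ((real k + 1) ^ 4 * exp (- c * real k)))"
  proof (intro suminf_le)
    show "ennreal ((real k + 1) ^ 4) * emeasure M {\<omega> \<in> space M. real k < X \<omega>}
        \<le> ennreal ((real k + 1) ^ 4 * exp (- c * real k))" for k
      using mult_left_mono[OF tail[of "real k"], of "ennreal ((real k + 1) ^ 4)"]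
      by (simp add: ennreal_mult)
  qed auto
  also have "\<dots> = ennreal (exp_tail_moment4 c)"
    unfolding exp_tail_moment4_def by (intro suminf_ennreal2 summable_exp_tail_moment4 c) auto
  finally show ?thesis .
qed

locale brownian = prob_space M for M :: "'a measure" +
  fixes F :: "real \<Rightarrow> 'a measure" and B :: "real \<Rightarrow> 'a \<Rightarrow> real"
  assumes filtered: "filtered_prob_space M F" and bm: "standard_brownian_motion M F B"
begin

lemma filtration_measurable:
  assumes "X \<in> borel_measurable (F s)" "0 \<le> s"
  shows "X \<in> borel_measurable M" "s \<le> t \<Longrightarrow> X \<in> borel_measurable (F t)"
  using filtered assms unfolding filtered_prob_space_def by (auto intro: measurable_from_subalg)

lemma B_adapted: "0 \<le> t \<Longrightarrow> B t \<in> borel_measurable (F t)"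
  using bm by (auto simp: standard_brownian_motion_def)

lemma B_measurable: "0 \<le> t \<Longrightarrow> B t \<in> borel_measurable M"
  using B_adapted filtration_measurable by blast

text \<open>
  The filtration property gives independence of sigma-algebras, and the one generated by \<open>X\<close>
  is contained in \<open>F s\<close>.
\<close>

lemma indep_increment:
  assumes X: "X \<in> borel_measurable (F s)" and st: "0 \<le> s" "s \<le> t"
  shows "indep_var borel X borel (\<lambda>\<omega>. B t \<omega> - B s \<omega>)"
proof -
  let ?D = "\<lambda>\<omega>. B t \<omega> - B s \<omega>"
  have sub: "subalgebra M (F s)" using filtered st by (auto simp: filtered_prob_space_def)
  have ind: "indep_set (sets (F s)) (sets (vimage_algebra (space M) ?D borel))"
    using bm st by (auto simp: standard_brownian_motion_def)
  have rvX: "random_variable borel X" using filtration_measurable(1)[OF X st(1)] .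
  have rvD: "random_variable borel ?D" using B_measurable st by (auto intro!: borel_measurable_diff)
  have A: "sigma_sets (space M) {X -` A \<inter> space M |A. A \<in> sets borel} \<subseteq> sets (F s)"
  proof -
    have "space (F s) = space M" using sub by (simp add: subalgebra_def)
    moreover have "{X -` A \<inter> space (F s) |A. A \<in> sets borel} \<subseteq> sets (F s)"
      using measurable_sets[OF X] by blast
    ultimately show ?thesis
      using sets.sigma_sets_subset[of "{X -` A \<inter> space M |A. A \<in> sets borel}" "F s"] by simp
  qed
  have C: "sigma_sets (space M) {?D -` A \<inter> space M |A. A \<in> sets borel} = sets (vimage_algebra (space M) ?D borel)"
    by (simp add: sets_vimage_algebra)
  have "indep_set (sigma_sets (space M) {X -` A \<inter> space M |A. A \<in> sets borel})
     (sets (vimage_algebra (space M) ?D borel))"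
    using indep_setD_ev1[OF ind] indep_setD_ev2[OF ind] indep_setD[OF ind] A
    by (intro indep_setI) blast+
  then show ?thesis unfolding indep_var_eq using rvX rvD C by simp
qed

lemma increment_distributed:
  "0 \<le> s \<Longrightarrow> s < t \<Longrightarrow> distributed M lborel (\<lambda>\<omega>. B t \<omega> - B s \<omega>) (normal_density 0 (sqrt (t - s)))"
  using bm by (auto simp: standard_brownian_motion_def)

text \<open>
  Exponential tilting turns the centred normal density into a shifted one.
\<close>

lemma increment_exp:
  assumes st: "0 \<le> s" "s < t"
  shows "(\<integral>\<^sup>+\<omega>. ennreal (exp (a * (B t \<omega> - B s \<omega>))) \<partial>M) = ennreal (exp (a\<^sup>2 * (t - s) / 2))"
proof -
  let ?d = "sqrt (t - s)"
  have d: "0 < ?d" "?d\<^sup>2 = t - s" using st by auto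
  have shift: "normal_density 0 ?d x * exp (a * x) = exp (a\<^sup>2 * (t - s) / 2) * normal_density (a * (t - s)) ?d x" for x
  proof -
    have "- (x - 0)\<^sup>2 / (2 * ?d\<^sup>2) + a * x = a\<^sup>2 * (t - s) / 2 + - (x - a * (t - s))\<^sup>2 / (2 * ?d\<^sup>2)"
      using st by (simp add: d(2) field_simps power2_eq_square)
    then have "exp (- (x - 0)\<^sup>2 / (2 * ?d\<^sup>2)) * exp (a * x)
        = exp (a\<^sup>2 * (t - s) / 2) * exp (- (x - a * (t - s))\<^sup>2 / (2 * ?d\<^sup>2))"
      by (simp only: exp_add[symmetric])
    then show ?thesis unfolding normal_density_def by simp
  qed
  have "(\<integral>\<^sup>+\<omega>. ennreal (exp (a * (B t \<omega> - B s \<omega>))) \<partial>M) =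
      (\<integral>\<^sup>+x. ennreal (normal_density 0 ?d x) * ennreal (exp (a * x)) \<partial>lborel)"
    using distributed_nn_integral[OF increment_distributed[OF st], of "\<lambda>x. ennreal (exp (a * x))"] by simp
  also have "\<dots> = (\<integral>\<^sup>+x. ennreal (exp (a\<^sup>2 * (t - s) / 2)) * ennreal (normal_density (a * (t - s)) ?d x) \<partial>lborel)"
    by (intro nn_integral_cong) (simp add: ennreal_mult[symmetric] shift)
  also have "\<dots> = ennreal (exp (a\<^sup>2 * (t - s) / 2)) * (\<integral>\<^sup>+x. ennreal (normal_density (a * (t - s)) ?d x) \<partial>lborel)"
    by (intro nn_integral_cmult) auto
  also have "(\<integral>\<^sup>+x. ennreal (normal_density (a * (t - s)) ?d x) \<partial>lborel) = 1"
    using d(1) by (subst nn_integral_eq_integral) auto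
  finally show ?thesis by simp
qed

text \<open>
  With \<open>g = 2 * \<theta> / \<sigma>\<^sup>2\<close>, conditioning on the increment \<open>\<xi>\<close> bounds the new tail by the
  expectation of \<open>exp (g * (x - \<xi>))\<close>, and \<open>g\<close> is exactly the exponent for which \<open>exp (- g * \<xi>)\<close> has
  mean one, whatever the length of the time step. Hence the same exponential tail is reproduced at
  every step and on every grid.
\<close>

lemma kingman_step:
  assumes X: "X \<in> borel_measurable (F s)" and st: "0 \<le> s" "s < t"
    and \<theta>: "\<theta> < 0" and \<sigma>: "\<sigma> \<noteq> 0"
    and tail: "\<And>x. 0 \<le> x \<Longrightarrow> emeasure M {\<omega> \<in> space M. x < X \<omega>} \<le> ennreal (exp (2 * \<theta> / \<sigma>\<^sup>2 * x))"
    and x: "0 \<le> x"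
  shows "emeasure M {\<omega> \<in> space M. x < max 0 (X \<omega> + (\<theta> * (t - s) + \<sigma> * (B t \<omega> - B s \<omega>)))}
    \<le> ennreal (exp (2 * \<theta> / \<sigma>\<^sup>2 * x))"
proof -
  define g where "g = 2 * \<theta> / \<sigma>\<^sup>2"
  have g: "g < 0" using \<theta> \<sigma> by (simp add: g_def field_simps)
  let ?D = "\<lambda>\<omega>. B t \<omega> - B s \<omega>"
  let ?h = "\<lambda>y. \<theta> * (t - s) + \<sigma> * y"
  have ind: "indep_var borel X borel ?D" using indep_increment X st by auto
  have [measurable]: "X \<in> borel_measurable M" "?D \<in> borel_measurable M"
    using indep_var_rv1[OF ind] indep_var_rv2[OF ind] by auto
  interpret DX: prob_space "distr M borel X" by (rule prob_space_distr) measurable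
  interpret DD: prob_space "distr M borel ?D" by (rule prob_space_distr) measurable
  interpret P: pair_sigma_finite "distr M borel X" "distr M borel ?D" ..
  have tail': "emeasure M {\<omega> \<in> space M. y < X \<omega>} \<le> ennreal (exp (g * y))" for y
  proof (cases "0 \<le> y")
    case True then show ?thesis using tail by (simp add: g_def)
  next
    case False
    then have "1 \<le> exp (g * y)" using g by (simp add: mult_nonpos_nonpos)
    then show ?thesis by (intro order_trans[OF emeasure_le_1]) simp
  qed
  let ?A = "{p :: real \<times> real. x < fst p + ?h (snd p)}"
  have "{p \<in> space (borel \<Otimes>\<^sub>M borel). x < fst p + ?h (snd p)} \<in> sets (borel \<Otimes>\<^sub>M borel)"
    by measurable
  then have "?A \<in> sets (borel \<Otimes>\<^sub>M borel)" by (simp add: space_pair_measure)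
  then have A[measurable]: "?A \<in> sets (distr M borel X \<Otimes>\<^sub>M distr M borel ?D)"
    by simp
  have "{\<omega> \<in> space M. x < max 0 (X \<omega> + ?h (?D \<omega>))} = (\<lambda>\<omega>. (X \<omega>, ?D \<omega>)) -` ?A \<inter> space M"
    using x by auto
  then have "emeasure M {\<omega> \<in> space M. x < max 0 (X \<omega> + ?h (?D \<omega>))}
     = emeasure (distr M (borel \<Otimes>\<^sub>M borel) (\<lambda>\<omega>. (X \<omega>, ?D \<omega>))) ?A"
    using A by (subst emeasure_distr) auto
  also have "\<dots> = emeasure (distr M borel X \<Otimes>\<^sub>M distr M borel ?D) ?A"
    using ind unfolding indep_var_distribution_eq by simp
  also have "\<dots> = (\<integral>\<^sup>+ y. emeasure (distr M borel X) ((\<lambda>x. (x, y)) -` ?A) \<partial>distr M borel ?D)"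
    by (rule P.emeasure_pair_measure_alt2) fact
  also have "\<dots> \<le> (\<integral>\<^sup>+ y. ennreal (exp (g * (x - ?h y))) \<partial>distr M borel ?D)"
  proof (rule nn_integral_mono)
    fix y
    have "(\<lambda>x. (x, y)) -` ?A = {x - ?h y<..}" by auto
    then have "emeasure (distr M borel X) ((\<lambda>x. (x, y)) -` ?A) = emeasure M {\<omega> \<in> space M. x - ?h y < X \<omega>}"
      by (simp add: emeasure_distr vimage_def Int_def conj_commute)
    then show "emeasure (distr M borel X) ((\<lambda>x. (x, y)) -` ?A) \<le> ennreal (exp (g * (x - ?h y)))"
      using tail' by simp
  qed
  also have "\<dots> = (\<integral>\<^sup>+ \<omega>. ennreal (exp (g * (x - ?h (?D \<omega>)))) \<partial>M)"
    by (rule nn_integral_distr) measurable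
  also have "\<dots> = (\<integral>\<^sup>+ \<omega>. ennreal (exp (g * x - g * \<theta> * (t - s))) * ennreal (exp (- g * \<sigma> * ?D \<omega>)) \<partial>M)"
    by (intro nn_integral_cong) (simp add: ennreal_mult[symmetric] exp_add[symmetric] algebra_simps)
  also have "\<dots> = ennreal (exp (g * x - g * \<theta> * (t - s))) * (\<integral>\<^sup>+ \<omega>. ennreal (exp (- g * \<sigma> * ?D \<omega>)) \<partial>M)"
    by (rule nn_integral_cmult) measurable
  also have "\<dots> = ennreal (exp (g * x - g * \<theta> * (t - s) + (- g * \<sigma>)\<^sup>2 * (t - s) / 2))"
    by (subst increment_exp[OF st]) (simp add: ennreal_mult[symmetric] exp_add)
  also have "g * x - g * \<theta> * (t - s) + (- g * \<sigma>)\<^sup>2 * (t - s) / 2 = g * x"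
    using \<sigma> by (simp add: g_def power_mult_distrib field_simps power2_eq_square)
  finally show ?thesis by (simp add: g_def)
qed

text \<open>
  Independence of \<open>X\<close> and the increment reduces the mixed moments to normal moments.
\<close>

lemma increment_moment:
  assumes X: "X \<in> borel_measurable (F s)" "integrable M X" and st: "0 \<le> s" "s < t"
  shows "has_bochner_integral M X (expectation X)" (is ?m0)
    "has_bochner_integral M (\<lambda>\<omega>. X \<omega> * (B t \<omega> - B s \<omega>)) 0" (is ?m1)
    "has_bochner_integral M (\<lambda>\<omega>. X \<omega> * (B t \<omega> - B s \<omega>) ^ 2) (expectation X * (t - s))" (is ?m2)
    "has_bochner_integral M (\<lambda>\<omega>. X \<omega> * (B t \<omega> - B s \<omega>) ^ 3) 0" (is ?m3)
    "has_bochner_integral M (\<lambda>\<omega>. X \<omega> * (B t \<omega> - B s \<omega>) ^ 4) (expectation X * (3 * (t - s)\<^sup>2))" (is ?m4)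
proof -
  let ?D = "\<lambda>\<omega>. B t \<omega> - B s \<omega>" and ?d = "sqrt (t - s)"
  have d: "0 < ?d" "?d\<^sup>2 = t - s" using st by auto
  have D: "distributed M lborel ?D (normal_density 0 ?d)" by (rule increment_distributed[OF st])
  have ind: "indep_var borel X borel ?D" using indep_increment X st by auto
  have [measurable]: "?D \<in> borel_measurable M" using indep_var_rv2[OF ind] by auto
  have *: "has_bochner_integral M (\<lambda>\<omega>. X \<omega> * ?D \<omega> ^ k) (expectation X * m)"
    if m: "has_bochner_integral lborel (\<lambda>x. normal_density 0 ?d x * (x - 0) ^ k) m" for k m
  proof -
    have "integrable (distr M lborel ?D) (\<lambda>x. x ^ k)"
      using m D unfolding distributed_distr_eq_density[OF D]
      by (subst integrable_real_density) (auto simp: has_bochner_integral_iff)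
    then have int: "integrable M (\<lambda>\<omega>. ?D \<omega> ^ k)"
      by (subst (asm) integrable_distr_eq) auto
    have val: "expectation (\<lambda>\<omega>. ?D \<omega> ^ k) = m"
      using distributed_integral[OF D, of "\<lambda>x. x ^ k"] m by (simp add: has_bochner_integral_iff)
    have ind': "indep_var borel X borel (\<lambda>\<omega>. ?D \<omega> ^ k)"
      using indep_var_compose[OF ind, of "\<lambda>x. x" borel "\<lambda>x. x ^ k" borel] by (simp add: o_def)
    show ?thesis
      using indep_var_integrable[OF ind' X(2) int] indep_var_lebesgue_integral[OF ind' X(2) int] val
      by (simp add: has_bochner_integral_iff)
  qed
  show ?m0 using X by (simp add: has_bochner_integral_integrable)
  show ?m1 using *[OF normal_moment_odd[OF d(1), of 0 0, simplified mult_0_right add_0]] by simp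
  show ?m3 using *[OF normal_moment_odd[OF d(1), of 0 1]] by (simp add: eval_nat_numeral)
  show ?m2 using *[OF normal_moment_even[OF d(1), of 0 1]] d by (simp add: eval_nat_numeral)
  have "fact (2 * 2) / ((2 / ?d\<^sup>2) ^ 2 * fact 2) = 3 * (t - s)\<^sup>2"
    using st unfolding d(2) by (simp add: fact_numeral power_divide)
  from normal_moment_even[OF d(1), of 0 2, unfolded this]
  have "has_bochner_integral lborel (\<lambda>x. normal_density 0 ?d x * (x - 0) ^ 4) (3 * (t - s)\<^sup>2)"
    by simp
  then show ?m4 by (rule *)
qed

end


section \<open>Second moment of the discretised Ito formula\<close>

text \<open>
  The Borel-Cantelli argument, in a form that combines it with an inner limit: by Fatou's
  lemma the bounds on the moments pass to the limits \<open>g m\<close>, the sum of which is then almost surely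
  finite. The limits are functionals of whole paths, which is why they enter only through
  measurable approximations.
\<close>

lemma AE_tendsto_0_if_summable_moments:
  fixes u :: "nat \<Rightarrow> nat \<Rightarrow> 'a \<Rightarrow> real" and g :: "nat \<Rightarrow> 'a \<Rightarrow> real" and c :: "nat \<Rightarrow> real"
  assumes [measurable]: "\<And>m N. u m N \<in> borel_measurable M"
    and nn: "\<And>m N \<omega>. 0 \<le> u m N \<omega>"
    and bound: "\<And>m N. (\<integral>\<^sup>+\<omega>. ennreal (u m N \<omega>) \<partial>M) \<le> ennreal (c m)"
    and c: "summable c" "\<And>m. 0 \<le> c m"
    and lim: "\<And>m. AE \<omega> in M. (\<lambda>N. u m N \<omega>) \<longlonglongrightarrow> g m \<omega>"
  shows "AE \<omega> in M. (\<lambda>m. g m \<omega>) \<longlonglongrightarrow> 0"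
proof -
  define G where "G m \<omega> = liminf (\<lambda>N. ennreal (u m N \<omega>))" for m \<omega>
  have [measurable]: "G m \<in> borel_measurable M" for m unfolding G_def by measurable
  have "(\<integral>\<^sup>+\<omega>. G m \<omega> \<partial>M) \<le> ennreal (c m)" for m
  proof -
    have "(\<integral>\<^sup>+\<omega>. G m \<omega> \<partial>M) \<le> liminf (\<lambda>N. \<integral>\<^sup>+\<omega>. ennreal (u m N \<omega>) \<partial>M)"
      unfolding G_def by (rule nn_integral_liminf) measurable
    also have "\<dots> \<le> liminf (\<lambda>N::nat. ennreal (c m))"
      by (intro Liminf_mono always_eventually allI bound)
    finally show ?thesis by (simp add: Liminf_const)
  qed
  then have "(\<Sum>m. \<integral>\<^sup>+\<omega>. G m \<omega> \<partial>M) \<le> (\<Sum>m. ennreal (c m))"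
    by (intro suminf_le) auto
  also have "\<dots> < \<infinity>" using c by (simp add: suminf_ennreal2 less_top[symmetric])
  finally have "(\<integral>\<^sup>+\<omega>. (\<Sum>m. G m \<omega>) \<partial>M) \<noteq> \<infinity>" by (simp add: nn_integral_suminf)
  then have "AE \<omega> in M. (\<Sum>m. G m \<omega>) \<noteq> \<infinity>" by (intro nn_integral_PInf_AE) auto
  moreover have "AE \<omega> in M. \<forall>m. (\<lambda>N. u m N \<omega>) \<longlonglongrightarrow> g m \<omega>" using lim by (simp add: AE_all_countable)
  ultimately show ?thesis
  proof eventually_elim
    case (elim \<omega>)
    have nng: "0 \<le> g m \<omega>" for m
      using elim nn by (intro LIMSEQ_le_const[of "\<lambda>N. u m N \<omega>"]) auto
    have "(\<lambda>N. ennreal (u m N \<omega>)) \<longlonglongrightarrow> ennreal (g m \<omega>)" for m using elim by (intro tendsto_ennrealI) auto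
    then have "G m \<omega> = ennreal (g m \<omega>)" for m
      unfolding G_def by (intro lim_imp_Liminf) auto
    with elim have "(\<Sum>m. ennreal (g m \<omega>)) \<noteq> top" by simp
    then have "summable (\<lambda>m. g m \<omega>)" by (intro summable_suminf_not_top nng)
    then show ?case by (rule summable_LIMSEQ_zero)
  qed
qed

lemma (in prob_space) integrable_product_of_squares:
  fixes X Y :: "'a \<Rightarrow> real"
  assumes [measurable]: "X \<in> borel_measurable M" "Y \<in> borel_measurable M"
    and XY: "integrable M (\<lambda>\<omega>. (X \<omega>)\<^sup>2)" "integrable M (\<lambda>\<omega>. (Y \<omega>)\<^sup>2)"
  shows "integrable M (\<lambda>\<omega>. X \<omega> * Y \<omega>)"
proof (rule Bochner_Integration.integrable_bound)
  show "integrable M (\<lambda>\<omega>. (X \<omega>)\<^sup>2 + (Y \<omega>)\<^sup>2)" using XY by simp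
  have "\<bar>x * y\<bar> \<le> x\<^sup>2 + y\<^sup>2" for x y :: real
    using sum_squares_bound[of "\<bar>x\<bar>" "\<bar>y\<bar>"] mult_nonneg_nonneg[of "\<bar>x\<bar>" "\<bar>y\<bar>"]
    unfolding abs_mult power2_abs by linarith
  then show "AE \<omega> in M. norm (X \<omega> * Y \<omega>) \<le> norm ((X \<omega>)\<^sup>2 + (Y \<omega>)\<^sup>2)"
    by (simp add: add_nonneg_nonneg abs_of_nonneg)
qed measurable

lemma (in prob_space) integrable_of_square:
  fixes X :: "'a \<Rightarrow> real"
  assumes "X \<in> borel_measurable M" "integrable M (\<lambda>\<omega>. (X \<omega>)\<^sup>2)"
  shows "integrable M X"
  using integrable_product_of_squares[of X "\<lambda>_. 1"] assms by simp

context brownian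
begin

text \<open>
  The added term is the increment over \<open>{s..t}\<close> of the martingale part in the square of the
  reflected walk. It is centred given \<open>F s\<close>, so all terms linear in it vanish.
\<close>

lemma martingale_step:
  assumes S: "S \<in> borel_measurable (F s)" "integrable M (\<lambda>\<omega>. S \<omega> ^ 2)"
    and V: "V \<in> borel_measurable (F s)" "integrable M (\<lambda>\<omega>. V \<omega> ^ 2)"
    and st: "0 \<le> s" "s < t"
  shows "has_bochner_integral M
      (\<lambda>\<omega>. (S \<omega> + (2 * \<sigma> * V \<omega> * (B t \<omega> - B s \<omega>) + \<sigma>\<^sup>2 * ((B t \<omega> - B s \<omega>)\<^sup>2 - (t - s)))) ^ 2)
      (expectation (\<lambda>\<omega>. S \<omega> ^ 2) + 4 * \<sigma>\<^sup>2 * (t - s) * expectation (\<lambda>\<omega>. V \<omega> ^ 2) + 2 * \<sigma> ^ 4 * (t - s)\<^sup>2)"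
proof -
  let ?b = "\<lambda>\<omega>. B t \<omega> - B s \<omega>" and ?d = "t - s"
  have [measurable]: "S \<in> borel_measurable M" "V \<in> borel_measurable M"
    using filtration_measurable(1) S V st by auto
  have intS: "integrable M S" and intV: "integrable M V"
    using S V by (auto intro: integrable_of_square)
  have intSV: "integrable M (\<lambda>\<omega>. S \<omega> * V \<omega>)"
    using S V by (intro integrable_product_of_squares) measurable
  have mS: "(\<lambda>\<omega>. S \<omega> ^ 2) \<in> borel_measurable (F s)" "(\<lambda>\<omega>. V \<omega> ^ 2) \<in> borel_measurable (F s)"
    "(\<lambda>\<omega>. S \<omega> * V \<omega>) \<in> borel_measurable (F s)" "(\<lambda>\<omega>. 1::real) \<in> borel_measurable (F s)"
    using S V by auto
  note mSS = increment_moment[OF mS(1) S(2) st] and mVV = increment_moment[OF mS(2) V(2) st]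
    and mSV = increment_moment[OF mS(3) intSV st] and m1 = increment_moment[OF mS(4) integrable_const st]
    and mS = increment_moment[OF S(1) intS st] and mV = increment_moment[OF V(1) intV st]
  note add = has_bochner_integral_add and mul = has_bochner_integral_mult_right
  have h: "has_bochner_integral M (\<lambda>\<omega>. S \<omega> ^ 2 + (4 * \<sigma> * (S \<omega> * V \<omega> * ?b \<omega>) + (2 * \<sigma>\<^sup>2 * (S \<omega> * ?b \<omega> ^ 2)
      + (- 2 * \<sigma>\<^sup>2 * ?d * S \<omega> + (4 * \<sigma>\<^sup>2 * (V \<omega> ^ 2 * ?b \<omega> ^ 2) + (4 * \<sigma> ^ 3 * (V \<omega> * ?b \<omega> ^ 3)
      + (- 4 * \<sigma> ^ 3 * ?d * (V \<omega> * ?b \<omega>) + (\<sigma> ^ 4 * (1 * ?b \<omega> ^ 4) + (- 2 * \<sigma> ^ 4 * ?d * (1 * ?b \<omega> ^ 2)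
      + \<sigma> ^ 4 * ?d\<^sup>2 * 1)))))))))
    (expectation (\<lambda>\<omega>. S \<omega> ^ 2) + (4 * \<sigma> * 0 + (2 * \<sigma>\<^sup>2 * (expectation S * ?d)
      + (- 2 * \<sigma>\<^sup>2 * ?d * expectation S + (4 * \<sigma>\<^sup>2 * (expectation (\<lambda>\<omega>. V \<omega> ^ 2) * ?d) + (4 * \<sigma> ^ 3 * 0
      + (- 4 * \<sigma> ^ 3 * ?d * 0 + (\<sigma> ^ 4 * (expectation (\<lambda>\<omega>. 1) * (3 * ?d\<^sup>2)) + (- 2 * \<sigma> ^ 4 * ?d * (expectation (\<lambda>\<omega>. 1) * ?d)
      + \<sigma> ^ 4 * ?d\<^sup>2 * expectation (\<lambda>\<omega>. 1))))))))))"
    (is "has_bochner_integral M ?f ?v")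
    by (rule add[OF mSS(1) add[OF mul[OF mSV(2)] add[OF mul[OF mS(3)] add[OF mul[OF mS(1)]
      add[OF mul[OF mVV(3)] add[OF mul[OF mV(4)] add[OF mul[OF mV(2)] add[OF mul[OF m1(5)]
      add[OF mul[OF m1(3)] mul[OF m1(1)]]]]]]]]]])
  have eq: "(S \<omega> + (2 * \<sigma> * V \<omega> * ?b \<omega> + \<sigma>\<^sup>2 * (?b \<omega> ^ 2 - ?d))) ^ 2 = S \<omega> ^ 2 + (4 * \<sigma> * (S \<omega> * V \<omega> * ?b \<omega>) + (2 * \<sigma>\<^sup>2 * (S \<omega> * ?b \<omega> ^ 2)
      + (- 2 * \<sigma>\<^sup>2 * ?d * S \<omega> + (4 * \<sigma>\<^sup>2 * (V \<omega> ^ 2 * ?b \<omega> ^ 2) + (4 * \<sigma> ^ 3 * (V \<omega> * ?b \<omega> ^ 3)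
      + (- 4 * \<sigma> ^ 3 * ?d * (V \<omega> * ?b \<omega>) + (\<sigma> ^ 4 * (1 * ?b \<omega> ^ 4) + (- 2 * \<sigma> ^ 4 * ?d * (1 * ?b \<omega> ^ 2)
      + \<sigma> ^ 4 * ?d\<^sup>2 * 1))))))))" for \<omega>
  proof -
    have "(S + (2 * \<sigma> * V * b + \<sigma>\<^sup>2 * (b ^ 2 - d))) ^ 2 = S ^ 2 + (4 * \<sigma> * (S * V * b) + (2 * \<sigma>\<^sup>2 * (S * b ^ 2)
      + (- 2 * \<sigma>\<^sup>2 * d * S + (4 * \<sigma>\<^sup>2 * (V ^ 2 * b ^ 2) + (4 * \<sigma> ^ 3 * (V * b ^ 3)
      + (- 4 * \<sigma> ^ 3 * d * (V * b) + (\<sigma> ^ 4 * (1 * b ^ 4) + (- 2 * \<sigma> ^ 4 * d * (1 * b ^ 2)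
      + \<sigma> ^ 4 * d\<^sup>2 * 1))))))))" for S V b d :: real
      by (simp add: eval_nat_numeral algebra_simps)
    then show ?thesis .
  qed
  have val: "?v = expectation (\<lambda>\<omega>. S \<omega> ^ 2) + 4 * \<sigma>\<^sup>2 * ?d * expectation (\<lambda>\<omega>. V \<omega> ^ 2) + 2 * \<sigma> ^ 4 * ?d\<^sup>2"
    by (simp add: prob_space algebra_simps power2_eq_square)
  show ?thesis unfolding eq using h unfolding val .
qed

definition drifted :: "real \<Rightarrow> real \<Rightarrow> 'a \<Rightarrow> real \<Rightarrow> real" where
  "drifted \<theta> \<sigma> \<omega> t = \<theta> * t + \<sigma> * B t \<omega>"

lemma AE_continuous_drifted: "AE \<omega> in M. \<forall>\<theta> \<sigma>. continuous_on {0..} (drifted \<theta> \<sigma> \<omega>)"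
proof -
  have "AE \<omega> in M. continuous_on {0..} (\<lambda>t. B t \<omega>)" using bm by (auto simp: standard_brownian_motion_def)
  then show ?thesis
    by eventually_elim (auto simp: drifted_def[abs_def] intro!: continuous_intros)
qed

text \<open>
  Up to terms that vanish as the mesh is refined, this is
  \<open>- 2 * \<theta> * integral {0..T} (reflect l) - \<sigma>\<^sup>2 * T\<close> for the path \<open>l = drifted \<theta> \<sigma> \<omega>\<close>. The correction
  terms make it exactly a martingale minus a square, see \<open>ito_defect_eq\<close>.
\<close>

definition ito_defect :: "real \<Rightarrow> real \<Rightarrow> real \<Rightarrow> nat \<Rightarrow> 'a \<Rightarrow> real" where
  "ito_defect \<theta> \<sigma> T N \<omega> = - 2 * \<theta> * (T / N * (\<Sum>n<N. lindley (grid_inc (drifted \<theta> \<sigma> \<omega>) T N) n)) - \<sigma>\<^sup>2 * T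
     + (\<Sum>n<N. (lindley_push (grid_inc (drifted \<theta> \<sigma> \<omega>) T N) n)\<^sup>2)
     - \<theta>\<^sup>2 * T * (T / N) - 2 * \<theta> * \<sigma> * (B T \<omega> - B 0 \<omega>) * (T / N)"

lemma rate_pos: "\<theta> < 0 \<Longrightarrow> \<sigma> \<noteq> 0 \<Longrightarrow> 0 < - 2 * \<theta> / \<sigma>\<^sup>2" for \<theta> \<sigma> :: real
  by (auto simp: divide_neg_pos)

context
  fixes \<theta> \<sigma> T :: real and N :: nat
  assumes \<theta>: "\<theta> < 0" and \<sigma>: "\<sigma> \<noteq> 0" and T: "0 < T" and N: "0 < N"
begin

abbreviation (input) grid_time :: "nat \<Rightarrow> real" where "grid_time n \<equiv> T * real n / real N"

abbreviation (input) V :: "nat \<Rightarrow> 'a \<Rightarrow> real" where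
  "V n \<omega> \<equiv> lindley (grid_inc (drifted \<theta> \<sigma> \<omega>) T N) n"

abbreviation (input) \<Delta>B :: "nat \<Rightarrow> 'a \<Rightarrow> real" where
  "\<Delta>B n \<omega> \<equiv> B (grid_time (Suc n)) \<omega> - B (grid_time n) \<omega>"

abbreviation (input) moment_bound :: real where "moment_bound \<equiv> exp_tail_moment4 (- 2 * \<theta> / \<sigma>\<^sup>2)"

lemma grid_time_bounds: "0 \<le> grid_time n" "grid_time n < grid_time (Suc n)" "grid_time (Suc n) - grid_time n = T / N"
  using T N by (auto simp: divide_simps algebra_simps)

lemma grid_inc_drifted:
  "grid_inc (drifted \<theta> \<sigma> \<omega>) T N n = \<theta> * (grid_time (Suc n) - grid_time n) + \<sigma> * \<Delta>B n \<omega>"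
  by (simp add: grid_inc_def drifted_def algebra_simps)

lemma lindley_Suc_drifted:
  "V (Suc n) \<omega> = max 0 (V n \<omega> + (\<theta> * (grid_time (Suc n) - grid_time n) + \<sigma> * \<Delta>B n \<omega>))"
  by (simp only: lindley.simps grid_inc_drifted[of \<omega> n])

lemma lindley_adapted: "V n \<in> borel_measurable (F (grid_time n))"
proof (induction n)
  case (Suc n)
  have [measurable]: "V n \<in> borel_measurable (F (grid_time (Suc n)))"
    "B (grid_time n) \<in> borel_measurable (F (grid_time (Suc n)))"
    "B (grid_time (Suc n)) \<in> borel_measurable (F (grid_time (Suc n)))"
    using filtration_measurable(2)[OF Suc] grid_time_bounds[of n] grid_time_bounds(1)[of "Suc n"]
      filtration_measurable(2)[OF B_adapted[OF grid_time_bounds(1)[of n]]] B_adapted by auto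
  show ?case unfolding lindley_Suc_drifted by measurable
qed simp

lemma lindley_measurable: "V n \<in> borel_measurable M"
  using filtration_measurable(1)[OF lindley_adapted grid_time_bounds(1)] .

lemma lindley_tail:
  "0 \<le> x \<Longrightarrow> emeasure M {\<omega> \<in> space M. x < V n \<omega>} \<le> ennreal (exp (2 * \<theta> / \<sigma>\<^sup>2 * x))"
proof (induction n arbitrary: x)
  case (Suc n)
  show ?case unfolding lindley_Suc_drifted
    by (rule kingman_step[OF lindley_adapted grid_time_bounds(1,2) \<theta> \<sigma> Suc.IH Suc.prems])
qed simp

lemma nn_lindley_moment4: "(\<integral>\<^sup>+\<omega>. ennreal (V n \<omega> ^ 4) \<partial>M) \<le> ennreal moment_bound"
  by (rule moment4_of_exp_tail[OF lindley_measurable lindley_nonneg rate_pos[OF \<theta> \<sigma>]])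
    (use lindley_tail in simp)

lemma lindley_moment4:
  "integrable M (\<lambda>\<omega>. V n \<omega> ^ 4)" "expectation (\<lambda>\<omega>. V n \<omega> ^ 4) \<le> moment_bound"
proof -
  note [measurable] = lindley_measurable
  show int: "integrable M (\<lambda>\<omega>. V n \<omega> ^ 4)"
  proof (rule integrableI_nonneg)
    show "(\<integral>\<^sup>+\<omega>. ennreal (V n \<omega> ^ 4) \<partial>M) < \<infinity>"
      using nn_lindley_moment4[of n] by (auto simp: order_le_less_trans)
  qed auto
  have "ennreal (expectation (\<lambda>\<omega>. V n \<omega> ^ 4)) \<le> ennreal moment_bound"
    using nn_lindley_moment4[of n] by (subst (asm) nn_integral_eq_integral[OF int]) auto
  then show "expectation (\<lambda>\<omega>. V n \<omega> ^ 4) \<le> moment_bound"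
    using exp_tail_moment4_nonneg[OF rate_pos[OF \<theta> \<sigma>]] by (simp add: ennreal_le_iff)
qed

lemma lindley_moment2:
  "integrable M (\<lambda>\<omega>. V n \<omega> ^ 2)" "expectation (\<lambda>\<omega>. V n \<omega> ^ 2) \<le> 1 + moment_bound"
proof -
  note [measurable] = lindley_measurable
  have le: "x\<^sup>2 \<le> 1 + x ^ 4" for x :: real
  proof -
    have "2 * x\<^sup>2 \<le> x ^ 4 + 1" using sum_squares_bound[of "x\<^sup>2" 1] by simp
    then show ?thesis using zero_le_power2[of x] by linarith
  qed
  have int: "integrable M (\<lambda>\<omega>. 1 + V n \<omega> ^ 4)" using lindley_moment4(1)[of n] by simp
  show int2: "integrable M (\<lambda>\<omega>. V n \<omega> ^ 2)"
    by (rule Bochner_Integration.integrable_bound[OF int]) (auto simp: le)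
  have "expectation (\<lambda>\<omega>. V n \<omega> ^ 2) \<le> expectation (\<lambda>\<omega>. 1 + V n \<omega> ^ 4)"
    by (intro integral_mono int int2 le)
  also have "\<dots> \<le> 1 + moment_bound" using lindley_moment4[of n] by (simp add: prob_space)
  finally show "expectation (\<lambda>\<omega>. V n \<omega> ^ 2) \<le> 1 + moment_bound" .
qed

abbreviation (input) D :: "nat \<Rightarrow> 'a \<Rightarrow> real" where
  "D n \<omega> \<equiv> 2 * \<sigma> * V n \<omega> * \<Delta>B n \<omega> + \<sigma>\<^sup>2 * ((\<Delta>B n \<omega>)\<^sup>2 - (grid_time (Suc n) - grid_time n))"

text \<open>
  Orthogonal increments whose variances are proportional to the mesh size. The condition on
  \<open>N\<close> makes the mesh size at most one, so that its square may be replaced by itself.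
\<close>

lemma martingale_sum:
  assumes TN: "T \<le> N"
  shows "(\<lambda>\<omega>. \<Sum>k<n. D k \<omega>) \<in> borel_measurable (F (grid_time n))
    \<and> integrable M (\<lambda>\<omega>. (\<Sum>k<n. D k \<omega>)\<^sup>2)
    \<and> expectation (\<lambda>\<omega>. (\<Sum>k<n. D k \<omega>)\<^sup>2) \<le> n * (T / N * (4 * \<sigma>\<^sup>2 * (1 + moment_bound) + 2 * \<sigma> ^ 4))"
proof (induction n)
  case (Suc n)
  have [measurable]: "V n \<in> borel_measurable (F (grid_time (Suc n)))"
    "B (grid_time n) \<in> borel_measurable (F (grid_time (Suc n)))"
    "B (grid_time (Suc n)) \<in> borel_measurable (F (grid_time (Suc n)))"
    "(\<lambda>\<omega>. \<Sum>k<n. D k \<omega>) \<in> borel_measurable (F (grid_time (Suc n)))"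
    using filtration_measurable(2)[OF lindley_adapted] grid_time_bounds[of n] grid_time_bounds(1)[of "Suc n"]
      filtration_measurable(2)[OF conjunct1[OF Suc]]
      filtration_measurable(2)[OF B_adapted[OF grid_time_bounds(1)[of n]]] B_adapted by auto
  have meas: "(\<lambda>\<omega>. \<Sum>k<Suc n. D k \<omega>) \<in> borel_measurable (F (grid_time (Suc n)))"
    unfolding sum.lessThan_Suc by measurable
  from Suc have S: "(\<lambda>\<omega>. \<Sum>k<n. D k \<omega>) \<in> borel_measurable (F (grid_time n))"
    "integrable M (\<lambda>\<omega>. (\<Sum>k<n. D k \<omega>)\<^sup>2)" by auto
  have step: "has_bochner_integral M (\<lambda>\<omega>. (\<Sum>k<Suc n. D k \<omega>)\<^sup>2)
    (expectation (\<lambda>\<omega>. (\<Sum>k<n. D k \<omega>)\<^sup>2) + 4 * \<sigma>\<^sup>2 * (T / N) * expectation (\<lambda>\<omega>. V n \<omega> ^ 2) + 2 * \<sigma> ^ 4 * (T / N)\<^sup>2)"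
    using martingale_step[OF S lindley_adapted lindley_moment2(1) grid_time_bounds(1,2), of \<sigma>]
    unfolding sum.lessThan_Suc grid_time_bounds(3) .
  have "(T / N)\<^sup>2 \<le> T / N * 1"
    unfolding power2_eq_square using T N TN by (intro mult_left_mono) auto
  then have "2 * \<sigma> ^ 4 * (T / N)\<^sup>2 \<le> 2 * \<sigma> ^ 4 * (T / N)" by (intro mult_left_mono) auto
  moreover have "4 * \<sigma>\<^sup>2 * (T / N) * expectation (\<lambda>\<omega>. V n \<omega> ^ 2) \<le> 4 * \<sigma>\<^sup>2 * (T / N) * (1 + moment_bound)"
    using T by (intro mult_left_mono lindley_moment2) auto
  ultimately have "expectation (\<lambda>\<omega>. (\<Sum>k<n. D k \<omega>)\<^sup>2) + 4 * \<sigma>\<^sup>2 * (T / N) * expectation (\<lambda>\<omega>. V n \<omega> ^ 2) + 2 * \<sigma> ^ 4 * (T / N)\<^sup>2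
    \<le> n * (T / N * (4 * \<sigma>\<^sup>2 * (1 + moment_bound) + 2 * \<sigma> ^ 4)) + 4 * \<sigma>\<^sup>2 * (T / N) * (1 + moment_bound) + 2 * \<sigma> ^ 4 * (T / N)"
    using Suc by linarith
  also have "\<dots> = (real n + 1) * (T / N * (4 * \<sigma>\<^sup>2 * (1 + moment_bound) + 2 * \<sigma> ^ 4))"
  proof -
    have "m * (d * (4 * a * c + e)) + 4 * a * d * c + e * d = (m + 1) * (d * (4 * a * c + e))"
      for m d a c e :: real by (simp add: algebra_simps)
    then show ?thesis .
  qed
  also have "real n + 1 = real (Suc n)" by simp
  finally show ?case using meas step by (simp only: has_bochner_integral_iff simp_thms)
qed simp

lemma ito_defect_eq: "ito_defect \<theta> \<sigma> T N \<omega> = (\<Sum>k<N. D k \<omega>) - (V N \<omega>)\<^sup>2"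
proof -
  let ?P = "lindley_push (grid_inc (drifted \<theta> \<sigma> \<omega>) T N)" and ?\<delta> = "T / N"
  have "(V N \<omega>)\<^sup>2 = (\<Sum>n<N. D n \<omega> + 2 * \<theta> * ?\<delta> * V n \<omega> + \<sigma>\<^sup>2 * ?\<delta> + \<theta>\<^sup>2 * ?\<delta>\<^sup>2
      + 2 * \<theta> * \<sigma> * ?\<delta> * \<Delta>B n \<omega> - (?P n)\<^sup>2)"
    unfolding lindley_square
  proof (rule sum.cong[OF refl])
    fix n
    have "2 * v * x + x\<^sup>2 - p\<^sup>2 = 2 * \<sigma> * v * b + \<sigma>\<^sup>2 * (b\<^sup>2 - d) + 2 * \<theta> * d * v + \<sigma>\<^sup>2 * d + \<theta>\<^sup>2 * d\<^sup>2
      + 2 * \<theta> * \<sigma> * d * b - p\<^sup>2" if "x = \<theta> * d + \<sigma> * b" for v x p b d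
      unfolding that by (simp add: power2_eq_square algebra_simps)
    from this[OF grid_inc_drifted[of \<omega> n]]
    show "2 * V n \<omega> * grid_inc (drifted \<theta> \<sigma> \<omega>) T N n + (grid_inc (drifted \<theta> \<sigma> \<omega>) T N n)\<^sup>2 - (?P n)\<^sup>2
      = D n \<omega> + 2 * \<theta> * ?\<delta> * V n \<omega> + \<sigma>\<^sup>2 * ?\<delta> + \<theta>\<^sup>2 * ?\<delta>\<^sup>2 + 2 * \<theta> * \<sigma> * ?\<delta> * \<Delta>B n \<omega> - (?P n)\<^sup>2"
      unfolding grid_time_bounds(3) by blast
  qed
  also have "\<dots> = (\<Sum>n<N. D n \<omega>) + 2 * \<theta> * ?\<delta> * (\<Sum>n<N. V n \<omega>) + N * (\<sigma>\<^sup>2 * ?\<delta>) + N * (\<theta>\<^sup>2 * ?\<delta>\<^sup>2)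
      + 2 * \<theta> * \<sigma> * ?\<delta> * (\<Sum>n<N. \<Delta>B n \<omega>) - (\<Sum>n<N. (?P n)\<^sup>2)"
    unfolding sum.distrib sum_subtractf sum_distrib_left[symmetric] by simp
  also have "(\<Sum>n<N. \<Delta>B n \<omega>) = B T \<omega> - B 0 \<omega>"
    using sum_lessThan_telescope[of "\<lambda>n. B (grid_time n) \<omega>" N] N by simp
  also have "N * (\<sigma>\<^sup>2 * ?\<delta>) = \<sigma>\<^sup>2 * T" using N by simp
  also have "N * (\<theta>\<^sup>2 * ?\<delta>\<^sup>2) = \<theta>\<^sup>2 * T * ?\<delta>" using N by (simp add: power2_eq_square)
  finally have e: "(V N \<omega>)\<^sup>2 = (\<Sum>n<N. D n \<omega>) + 2 * \<theta> * ?\<delta> * (\<Sum>n<N. V n \<omega>) + \<sigma>\<^sup>2 * T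
    + \<theta>\<^sup>2 * T * ?\<delta> + 2 * \<theta> * \<sigma> * ?\<delta> * (B T \<omega> - B 0 \<omega>) - (\<Sum>n<N. (?P n)\<^sup>2)" .
  have "- 2 * \<theta> * (d * A) - s + P - t - 2 * \<theta> * \<sigma> * b * d = S - v"
    if "v = S + 2 * \<theta> * d * A + s + t + 2 * \<theta> * \<sigma> * d * b - P" for v S d A s t b P :: real
    unfolding that by (simp add: algebra_simps)
  from this[OF e] show ?thesis unfolding ito_defect_def .
qed

lemma ito_defect_measurable: "ito_defect \<theta> \<sigma> T N \<in> borel_measurable M"
proof -
  have [measurable]: "V n \<in> borel_measurable M" "B (grid_time n) \<in> borel_measurable M" for n
    using lindley_measurable B_measurable[OF grid_time_bounds(1)] by auto
  show ?thesis unfolding ito_defect_eq[abs_def] by measurable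
qed

lemma ito_defect_moment:
  assumes TN: "T \<le> N"
  shows "(\<integral>\<^sup>+\<omega>. ennreal ((ito_defect \<theta> \<sigma> T N \<omega>)\<^sup>2) \<partial>M) \<le> ennreal (2 * T * (4 * \<sigma>\<^sup>2 * (1 + moment_bound) + 2 * \<sigma> ^ 4) + 2 * moment_bound)"
proof -
  note S = martingale_sum[OF TN, of N] and V4 = lindley_moment4[of N]
  have int: "integrable M (\<lambda>\<omega>. 2 * (\<Sum>k<N. D k \<omega>)\<^sup>2 + 2 * V N \<omega> ^ 4)"
    using S V4 by auto
  have "(\<integral>\<^sup>+\<omega>. ennreal ((ito_defect \<theta> \<sigma> T N \<omega>)\<^sup>2) \<partial>M) \<le> (\<integral>\<^sup>+\<omega>. ennreal (2 * (\<Sum>k<N. D k \<omega>)\<^sup>2 + 2 * V N \<omega> ^ 4) \<partial>M)"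
  proof (intro nn_integral_mono ennreal_leI)
    fix \<omega>
    have "(a - v\<^sup>2)\<^sup>2 \<le> 2 * a\<^sup>2 + 2 * v ^ 4" for a v :: real
      using zero_le_power2[of "a + v\<^sup>2"] by (simp add: power2_eq_square power4_eq_xxxx algebra_simps)
    then show "(ito_defect \<theta> \<sigma> T N \<omega>)\<^sup>2 \<le> 2 * (\<Sum>k<N. D k \<omega>)\<^sup>2 + 2 * V N \<omega> ^ 4"
      unfolding ito_defect_eq .
  qed
  also have "\<dots> = ennreal (expectation (\<lambda>\<omega>. 2 * (\<Sum>k<N. D k \<omega>)\<^sup>2 + 2 * V N \<omega> ^ 4))"
    by (intro nn_integral_eq_integral int) auto
  also have "expectation (\<lambda>\<omega>. 2 * (\<Sum>k<N. D k \<omega>)\<^sup>2 + 2 * V N \<omega> ^ 4)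
      = 2 * expectation (\<lambda>\<omega>. (\<Sum>k<N. D k \<omega>)\<^sup>2) + 2 * expectation (\<lambda>\<omega>. V N \<omega> ^ 4)"
    using S V4 by (subst Bochner_Integration.integral_add) auto
  also have "\<dots> \<le> 2 * (N * (T / N * (4 * \<sigma>\<^sup>2 * (1 + moment_bound) + 2 * \<sigma> ^ 4))) + 2 * moment_bound"
    using S V4 by (intro add_mono mult_left_mono) auto
  also have "\<dots> = 2 * T * (4 * \<sigma>\<^sup>2 * (1 + moment_bound) + 2 * \<sigma> ^ 4) + 2 * moment_bound" using N by simp
  finally show ?thesis by (simp add: ennreal_leI)
qed

end

end


context brownian
begin

lemma ito_defect_tendsto:
  assumes cont: "continuous_on {0..} (drifted \<theta> \<sigma> \<omega>)" and T: "0 < T"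
  shows "(\<lambda>N. ito_defect \<theta> \<sigma> T N \<omega>) \<longlonglongrightarrow> - 2 * \<theta> * integral {0..T} (reflect (drifted \<theta> \<sigma> \<omega>)) - \<sigma>\<^sup>2 * T"
proof -
  have TN: "(\<lambda>N. T / real N) \<longlonglongrightarrow> 0"
    by (intro real_tendsto_divide_at_top filterlim_real_sequentially) auto
  have "(\<lambda>N. ito_defect \<theta> \<sigma> T N \<omega>) \<longlonglongrightarrow> - 2 * \<theta> * integral {0..T} (reflect (drifted \<theta> \<sigma> \<omega>)) - \<sigma>\<^sup>2 * T
      + 0 - \<theta>\<^sup>2 * T * 0 - 2 * \<theta> * \<sigma> * (B T \<omega> - B 0 \<omega>) * 0"
    unfolding ito_defect_def
    by (intro tendsto_add tendsto_diff tendsto_mult tendsto_const lindley_riemann_tendsto[OF cont T]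
        lindley_push_square_tendsto[OF cont T] TN)
  then show ?thesis by simp
qed

text \<open>
  The second moment of the time average minus its limit is of order \<open>1 / T\<close>, which is
  summable along \<open>T = m\<^sup>2\<close>.
\<close>

lemma reflect_mean_squares:
  assumes \<theta>: "\<theta> < 0" and \<sigma>: "\<sigma> \<noteq> 0"
  shows "AE \<omega> in M. (\<lambda>m. integral {0..(real (Suc m))\<^sup>2} (reflect (drifted \<theta> \<sigma> \<omega>)) / (real (Suc m))\<^sup>2)
     \<longlonglongrightarrow> \<sigma>\<^sup>2 / (- 2 * \<theta>)"
proof -
  let ?T = "\<lambda>m. (real (Suc m))\<^sup>2"
  let ?moment_bound = "exp_tail_moment4 (- 2 * \<theta> / \<sigma>\<^sup>2)"
  define K where "K = 2 * (4 * \<sigma>\<^sup>2 * (1 + ?moment_bound) + 2 * \<sigma> ^ 4) + 2 * ?moment_bound"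
  have moment_bound: "0 \<le> ?moment_bound" using \<theta> \<sigma> by (intro exp_tail_moment4_nonneg rate_pos)
  then have K: "0 \<le> K" unfolding K_def by (intro add_nonneg_nonneg mult_nonneg_nonneg) auto
  \<comment> \<open>The mesh count exceeds the horizon, so that the mesh size is at most one.\<close>
  let ?N = "\<lambda>m N. N + (Suc m)\<^sup>2"
  let ?Q = "\<lambda>m N \<omega>. ito_defect \<theta> \<sigma> (?T m) (?N m N) \<omega>"
  let ?G = "\<lambda>m \<omega>. - 2 * \<theta> * integral {0..?T m} (reflect (drifted \<theta> \<sigma> \<omega>)) - \<sigma>\<^sup>2 * ?T m"
  have "AE \<omega> in M. (\<lambda>m. (?G m \<omega> / ?T m)\<^sup>2) \<longlonglongrightarrow> 0"
  proof (rule AE_tendsto_0_if_summable_moments)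
    show "(\<lambda>\<omega>. (?Q m N \<omega> / ?T m)\<^sup>2) \<in> borel_measurable M" for m N
      by (intro borel_measurable_power borel_measurable_divide ito_defect_measurable \<theta> \<sigma>) auto
    show "(\<integral>\<^sup>+\<omega>. ennreal ((?Q m N \<omega> / ?T m)\<^sup>2) \<partial>M) \<le> ennreal (K / (real (Suc m))\<^sup>2)" for m N
    proof -
      have T1: "1 \<le> ?T m" by simp
      have TN: "?T m \<le> real (?N m N)" by (simp del: of_nat_Suc)
      have [measurable]: "?Q m N \<in> borel_measurable M"
        by (intro ito_defect_measurable \<theta> \<sigma>) auto
      have "(\<integral>\<^sup>+\<omega>. ennreal ((?Q m N \<omega> / ?T m)\<^sup>2) \<partial>M) = (\<integral>\<^sup>+\<omega>. ennreal (1 / (?T m)\<^sup>2) * ennreal ((?Q m N \<omega>)\<^sup>2) \<partial>M)"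
        by (intro nn_integral_cong) (simp add: ennreal_mult[symmetric] power_divide del: of_nat_Suc)
      also have "\<dots> = ennreal (1 / (?T m)\<^sup>2) * (\<integral>\<^sup>+\<omega>. ennreal ((?Q m N \<omega>)\<^sup>2) \<partial>M)"
        by (rule nn_integral_cmult) measurable
      also have "\<dots> \<le> ennreal (1 / (?T m)\<^sup>2) * ennreal (?T m * K)"
      proof (intro mult_left_mono order_trans[OF ito_defect_moment] ennreal_leI)
        have "2 * ?moment_bound \<le> ?T m * (2 * ?moment_bound)" using mult_right_mono[OF T1, of "2 * ?moment_bound"] moment_bound by simp
        moreover have "t * (2 * a + c) = 2 * t * a + t * c" for t a c :: real by (simp add: algebra_simps)
        ultimately show "2 * ?T m * (4 * \<sigma>\<^sup>2 * (1 + ?moment_bound) + 2 * \<sigma> ^ 4) + 2 * ?moment_bound \<le> ?T m * K"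
          unfolding K_def by (simp only: add_left_mono)
      qed (use \<theta> \<sigma> TN in auto)
      also have "\<dots> = ennreal (K / (real (Suc m))\<^sup>2)"
        using K by (subst ennreal_mult[symmetric]) (auto simp: power2_eq_square)
      finally show ?thesis .
    qed
    have "summable (\<lambda>m. K * (1 / (real (Suc m))\<^sup>2))"
      using inverse_squares_sums by (intro summable_mult sums_summable) (auto simp: add.commute)
    then show "summable (\<lambda>m. K / (real (Suc m))\<^sup>2)" by simp
    show "AE \<omega> in M. (\<lambda>N. (?Q m N \<omega> / ?T m)\<^sup>2) \<longlonglongrightarrow> (?G m \<omega> / ?T m)\<^sup>2" for m
      using AE_continuous_drifted
    proof eventually_elim
      case (elim \<omega>)
      have "(\<lambda>N. ito_defect \<theta> \<sigma> (?T m) N \<omega>) \<longlonglongrightarrow> ?G m \<omega>"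
        using elim by (intro ito_defect_tendsto) auto
      from LIMSEQ_ignore_initial_segment[OF this, of "(Suc m)\<^sup>2"]
      show ?case by (intro tendsto_intros) auto
    qed
  qed (use K in auto)
  then show ?thesis
  proof eventually_elim
    case (elim \<omega>)
    have "(\<lambda>m. ?G m \<omega> / ?T m) \<longlonglongrightarrow> 0"
      using tendsto_real_sqrt[OF elim] by (simp only: real_sqrt_abs tendsto_rabs_zero_iff real_sqrt_zero)
    from tendsto_divide[OF tendsto_add[OF this tendsto_const[of "\<sigma>\<^sup>2"]] tendsto_const[of "- 2 * \<theta>"]]
    have "(\<lambda>m. (?G m \<omega> / ?T m + \<sigma>\<^sup>2) / (- 2 * \<theta>)) \<longlonglongrightarrow> \<sigma>\<^sup>2 / (- 2 * \<theta>)"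
      using \<theta> by auto
    moreover have "(?G m \<omega> / ?T m + \<sigma>\<^sup>2) / (- 2 * \<theta>) = integral {0..?T m} (reflect (drifted \<theta> \<sigma> \<omega>)) / ?T m" for m
    proof -
      have "((- 2 * \<theta> * I - s * t) / t + s) / (- 2 * \<theta>) = I / t" if "t \<noteq> 0" for I s t
        using \<theta> that by (simp add: field_simps)
      then show ?thesis by simp
    qed
    ultimately show ?case by simp
  qed
qed

text \<open>
  The fourth moments of \<open>reflect\<close> are bounded in time, so the quotients are summable in
  fourth mean.
\<close>

lemma reflect_sublinear:
  assumes \<theta>: "\<theta> < 0" and \<sigma>: "\<sigma> \<noteq> 0"
  shows "AE \<omega> in M. (\<lambda>m. reflect (drifted \<theta> \<sigma> \<omega>) (real (Suc m)) / real (Suc m)) \<longlonglongrightarrow> 0"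
proof -
  let ?T = "\<lambda>m. real (Suc m)"
  let ?moment_bound = "exp_tail_moment4 (- 2 * \<theta> / \<sigma>\<^sup>2)"
  have moment_bound: "0 \<le> ?moment_bound" using \<theta> \<sigma> by (intro exp_tail_moment4_nonneg rate_pos)
  let ?V = "\<lambda>m N \<omega>. lindley (grid_inc (drifted \<theta> \<sigma> \<omega>) (?T m) (Suc N)) (Suc N)"
  have "AE \<omega> in M. (\<lambda>m. (reflect (drifted \<theta> \<sigma> \<omega>) (?T m) / ?T m) ^ 4) \<longlonglongrightarrow> 0"
  proof (rule AE_tendsto_0_if_summable_moments)
    show "(\<lambda>\<omega>. (?V m N \<omega> / ?T m) ^ 4) \<in> borel_measurable M" for m N
      by (intro borel_measurable_power borel_measurable_divide lindley_measurable \<theta> \<sigma>) auto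
    show "(\<integral>\<^sup>+\<omega>. ennreal ((?V m N \<omega> / ?T m) ^ 4) \<partial>M) \<le> ennreal (?moment_bound / (?T m)\<^sup>2)" for m N
    proof -
      have [measurable]: "?V m N \<in> borel_measurable M"
        by (intro lindley_measurable \<theta> \<sigma>) auto
      have "(\<integral>\<^sup>+\<omega>. ennreal ((?V m N \<omega> / ?T m) ^ 4) \<partial>M) = (\<integral>\<^sup>+\<omega>. ennreal (1 / ?T m ^ 4) * ennreal (?V m N \<omega> ^ 4) \<partial>M)"
        by (intro nn_integral_cong) (simp add: ennreal_mult[symmetric] power_divide del: of_nat_Suc lindley.simps)
      also have "\<dots> = ennreal (1 / ?T m ^ 4) * (\<integral>\<^sup>+\<omega>. ennreal (?V m N \<omega> ^ 4) \<partial>M)"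
        by (rule nn_integral_cmult) measurable
      also have "\<dots> \<le> ennreal (1 / (?T m)\<^sup>2) * ennreal ?moment_bound"
      proof (intro mult_mono nn_lindley_moment4 ennreal_leI \<theta> \<sigma>)
        have "(?T m)\<^sup>2 \<le> ?T m ^ 4" by (intro power_increasing) auto
        then show "1 / ?T m ^ 4 \<le> 1 / (?T m)\<^sup>2" by (intro divide_left_mono) auto
      qed auto
      also have "\<dots> = ennreal (?moment_bound / (?T m)\<^sup>2)"
        using moment_bound by (subst ennreal_mult[symmetric]) auto
      finally show ?thesis .
    qed
    have "summable (\<lambda>m. ?moment_bound * (1 / (real (Suc m))\<^sup>2))"
      using inverse_squares_sums by (intro summable_mult sums_summable) (auto simp: add.commute)
    then show "summable (\<lambda>m. ?moment_bound / (?T m)\<^sup>2)" by simp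
    show "AE \<omega> in M. (\<lambda>N. (?V m N \<omega> / ?T m) ^ 4) \<longlonglongrightarrow> (reflect (drifted \<theta> \<sigma> \<omega>) (?T m) / ?T m) ^ 4" for m
      using AE_continuous_drifted
    proof eventually_elim
      case (elim \<omega>)
      have "(\<lambda>N. lindley (grid_inc (drifted \<theta> \<sigma> \<omega>) (?T m) N) N) \<longlonglongrightarrow> reflect (drifted \<theta> \<sigma> \<omega>) (?T m)"
        using elim by (intro lindley_grid_tendsto) auto
      from LIMSEQ_Suc[OF this] show ?case by (intro tendsto_intros) auto
    qed
  qed (use moment_bound in auto)
  then show ?thesis
  proof eventually_elim
    case (elim \<omega>)
    have "(\<lambda>m. root 4 ((reflect (drifted \<theta> \<sigma> \<omega>) (?T m) / ?T m) ^ 4)) \<longlonglongrightarrow> root 4 0"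
      by (intro tendsto_real_root elim)
    moreover have "root 4 (x ^ 4) = \<bar>x\<bar>" for x :: real
      using real_root_power_cancel[of 4 "\<bar>x\<bar>"] by (simp add: power_even_abs)
    ultimately show ?case by (simp only: tendsto_rabs_zero_iff real_root_zero)
  qed
qed

end


section \<open>Linear growth and long-run averages\<close>

text \<open>
  The integral of a nonnegative function is monotone in the horizon, and consecutive squares
  have a ratio tending to one.
\<close>

lemma mean_tendsto_from_squares:
  fixes f :: "real \<Rightarrow> real"
  assumes f: "continuous_on {0..} f" and nn: "\<And>t. 0 \<le> t \<Longrightarrow> 0 \<le> f t"
    and lim: "(\<lambda>m. integral {0..(real (Suc m))\<^sup>2} f / (real (Suc m))\<^sup>2) \<longlonglongrightarrow> c"
  shows "((\<lambda>T. integral {0..T} f / T) \<longlongrightarrow> c) at_top"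
proof -
  define I where "I T = integral {0..T} f" for T
  define J where "J m = I ((real (Suc m))\<^sup>2) / (real (Suc m))\<^sup>2" for m
  have J: "J \<longlonglongrightarrow> c" using lim by (simp add: J_def[abs_def] I_def)
  have int: "f integrable_on {0..T}" for T
    by (intro integrable_continuous_interval continuous_on_subset[OF f]) auto
  have mono: "I s \<le> I t" if "s \<le> t" for s t
    unfolding I_def by (intro integral_subset_le int) (use that nn in auto)
  have I0: "0 \<le> I t" for t unfolding I_def by (intro integral_nonneg int) (use nn in auto)
  define k where "k T = nat \<lfloor>sqrt T\<rfloor> - 1" for T
  have k: "(real (Suc (k T)))\<^sup>2 \<le> T" "T \<le> (real (Suc (Suc (k T))))\<^sup>2" if "1 \<le> T" for T
  proof -
    have "1 \<le> sqrt T" using that by simp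
    then have a: "real (Suc (k T)) \<le> sqrt T" "sqrt T \<le> real (Suc (Suc (k T)))" unfolding k_def by linarith+
    then have "(real (Suc (k T)))\<^sup>2 \<le> (sqrt T)\<^sup>2" "(sqrt T)\<^sup>2 \<le> (real (Suc (Suc (k T))))\<^sup>2"
      using power_mono[OF a(1), of 2] power_mono[OF a(2), of 2] that by (auto simp del: of_nat_Suc)
    then show "(real (Suc (k T)))\<^sup>2 \<le> T" "T \<le> (real (Suc (Suc (k T))))\<^sup>2" using that by auto
  qed
  have klim: "filterlim k sequentially at_top"
    unfolding filterlim_at_top
  proof
    fix n :: nat
    show "\<forall>\<^sub>F T in at_top. n \<le> k T"
      using eventually_ge_at_top[of "(real (n + 1))\<^sup>2"]
    proof eventually_elim
      case (elim T)
      then have "real (n + 1) \<le> sqrt T" by (intro real_le_rsqrt)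
      then show ?case unfolding k_def by linarith
    qed
  qed
  define q where "q m = (real (Suc m) / real (Suc (Suc m)))\<^sup>2" for m
  have q: "q \<longlonglongrightarrow> 1"
  proof -
    have "(\<lambda>n. real n / real (Suc n)) \<longlonglongrightarrow> 1" by (rule LIMSEQ_n_over_Suc_n)
    from tendsto_power[OF LIMSEQ_Suc[OF this], of 2] show ?thesis by (simp add: q_def[abs_def])
  qed
  show ?thesis
  proof (rule tendsto_sandwich)
    show "((\<lambda>T. J (k T) * q (k T)) \<longlongrightarrow> c) at_top"
      using filterlim_compose[OF tendsto_mult[OF J q] klim] by simp
    show "((\<lambda>T. J (Suc (k T)) / q (k T)) \<longlongrightarrow> c) at_top"
      using filterlim_compose[OF tendsto_divide[OF LIMSEQ_Suc[OF J] q] klim] by simp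
    show "\<forall>\<^sub>F T in at_top. J (k T) * q (k T) \<le> integral {0..T} f / T"
      using eventually_ge_at_top[of 1]
    proof eventually_elim
      case (elim T)
      have "J (k T) * q (k T) = I ((real (Suc (k T)))\<^sup>2) / (real (Suc (Suc (k T))))\<^sup>2"
        by (simp add: J_def q_def power_divide del: of_nat_Suc)
      also have "\<dots> \<le> I T / T"
        using k[OF elim] elim I0 by (intro frac_le mono) auto
      finally show ?case by (simp add: I_def)
    qed
    show "\<forall>\<^sub>F T in at_top. integral {0..T} f / T \<le> J (Suc (k T)) / q (k T)"
      using eventually_ge_at_top[of 1]
    proof eventually_elim
      case (elim T)
      have "I T / T \<le> I ((real (Suc (Suc (k T))))\<^sup>2) / (real (Suc (k T)))\<^sup>2"
        using k[OF elim] elim I0 by (intro frac_le mono) auto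
      also have "\<dots> = J (Suc (k T)) / q (k T)"
        by (simp add: J_def q_def power_divide del: of_nat_Suc)
      finally show ?case by (simp add: I_def)
    qed
  qed
qed

lemma linear_growth_bound:
  fixes l :: "real \<Rightarrow> real"
  assumes cont: "continuous_on {0..} l" and lim: "((\<lambda>t. l t / t) \<longlongrightarrow> \<theta>) at_top" and "0 < e"
  obtains C where "0 \<le> C" "\<And>t. 0 \<le> t \<Longrightarrow> \<bar>l t - \<theta> * t\<bar> \<le> e * t + C"
proof -
  have "\<forall>\<^sub>F t in at_top. dist (l t / t) \<theta> < e" using tendstoD[OF lim \<open>0 < e\<close>] .
  then obtain U0 where U0: "\<And>t. U0 \<le> t \<Longrightarrow> dist (l t / t) \<theta> < e" by (auto simp: eventually_at_top_linorder)
  define U where "U = max U0 1"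
  have far: "\<bar>l t - \<theta> * t\<bar> \<le> e * t" if "U \<le> t" for t
  proof -
    have t: "0 < t" "U0 \<le> t" using that by (auto simp: U_def)
    have "\<bar>l t / t - \<theta>\<bar> * t \<le> e * t" using U0[OF t(2)] t by (intro mult_right_mono) (auto simp: dist_real_def)
    moreover have "\<bar>l t / t - \<theta>\<bar> * t = \<bar>(l t / t - \<theta>) * t\<bar>" using t by (simp add: abs_mult)
    moreover have "(l t / t - \<theta>) * t = l t - \<theta> * t" using t by (simp add: algebra_simps)
    ultimately show ?thesis by simp
  qed
  have "compact ((\<lambda>t. l t - \<theta> * t) ` {0..U})"
    by (intro compact_continuous_image continuous_intros continuous_on_subset[OF cont]) auto
  from compact_imp_bounded[OF this] obtain C where C: "\<And>t. t \<in> {0..U} \<Longrightarrow> \<bar>l t - \<theta> * t\<bar> \<le> C"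
    unfolding bounded_iff by (fastforce simp: image_iff)
  show ?thesis
  proof
    show "0 \<le> max C 0" by simp
    fix t :: real assume t: "0 \<le> t"
    show "\<bar>l t - \<theta> * t\<bar> \<le> e * t + max C 0"
    proof (cases "U \<le> t")
      case True
      then show ?thesis using far[of t] by linarith
    next
      case False
      then have "\<bar>l t - \<theta> * t\<bar> \<le> C" "0 \<le> e * t" using C[of t] t \<open>0 < e\<close> by auto
      then show ?thesis by linarith
    qed
  qed
qed

context brownian
begin

text \<open>
  The bounded moments of reflected processes already contain this law of large numbers. For
  drift \<open>- \<eta>\<close> and noise \<open>B\<close> or \<open>- B\<close>, sublinearity of \<open>reflect\<close> at time \<open>n\<close> controls
  \<open>\<bar>B n - B u\<bar>\<close> by a small multiple of \<open>n\<close> simultaneously for all \<open>u \<le> n\<close>, which covers the times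
  between integers as well.
\<close>

lemma B_sublinear: "AE \<omega> in M. ((\<lambda>t. B t \<omega> / t) \<longlongrightarrow> 0) at_top"
proof -
  let ?\<eta> = "\<lambda>j::nat. - (1 / real (Suc j))"
  have "AE \<omega> in M. \<forall>j. (\<lambda>m. reflect (drifted (?\<eta> j) s \<omega>) (real (Suc m)) / real (Suc m)) \<longlonglongrightarrow> 0"
    if "s \<noteq> 0" for s
    unfolding AE_all_countable by (intro allI reflect_sublinear that) auto
  from this[of 1] this[of "-1"] AE_continuous_drifted
  have "AE \<omega> in M. (\<forall>j. (\<lambda>m. reflect (drifted (?\<eta> j) 1 \<omega>) (real (Suc m)) / real (Suc m)) \<longlonglongrightarrow> 0)
    \<and> (\<forall>j. (\<lambda>m. reflect (drifted (?\<eta> j) (-1) \<omega>) (real (Suc m)) / real (Suc m)) \<longlonglongrightarrow> 0)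
    \<and> (\<forall>\<theta> \<sigma>. continuous_on {0..} (drifted \<theta> \<sigma> \<omega>)) \<and> B 0 \<omega> = 0"
    using bm unfolding standard_brownian_motion_def by auto
  then show ?thesis
  proof eventually_elim
    case (elim \<omega>)
    show ?case
    proof (rule tendstoI)
      fix e :: real assume e: "0 < e"
      \<comment> \<open>Below, \<open>\<bar>B t\<bar> / t\<close> is bounded by \<open>8 * d\<close>.\<close>
      define d where "d = e / 10"
      have d: "0 < d" using e by (simp add: d_def)
      obtain j where j: "1 / real (Suc j) < d" using d nat_approx_posE by blast
      have up: "\<forall>\<^sub>F m in sequentially. reflect (drifted (?\<eta> j) s \<omega>) (real (Suc m)) / real (Suc m) < d"
        if "s = 1 \<or> s = -1" for s
      proof -
        have "(\<lambda>m. reflect (drifted (?\<eta> j) s \<omega>) (real (Suc m)) / real (Suc m)) \<longlonglongrightarrow> 0"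
          using that elim by blast
        from order_tendstoD(2)[OF this d] show ?thesis .
      qed
      obtain m0 where m0: "\<And>m s. m0 \<le> m \<Longrightarrow> s = 1 \<or> s = -1 \<Longrightarrow> reflect (drifted (?\<eta> j) s \<omega>) (real (Suc m)) / real (Suc m) < d"
        using eventually_conj[OF up[of 1] up[of "-1"]] unfolding eventually_sequentially by blast
      show "\<forall>\<^sub>F t in at_top. dist (B t \<omega> / t) 0 < e"
        using eventually_ge_at_top[of "real (Suc m0)"]
      proof eventually_elim
        case t: (elim t)
        then have t1: "1 \<le> t" by simp
        define m where "m = nat \<lceil>t\<rceil> - 1"
        have n: "t \<le> real (Suc m)" "real (Suc m) \<le> t + 1" "m0 \<le> m" using t unfolding m_def by linarith+
        have diff: "s * (B (real (Suc m)) \<omega> - B u \<omega>) \<le> 2 * d * real (Suc m)"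
          if s: "s = 1 \<or> s = -1" and u: "0 \<le> u" "u \<le> real (Suc m)" for s u
        proof -
          have "drifted (?\<eta> j) s \<omega> (real (Suc m)) - drifted (?\<eta> j) s \<omega> u \<le> reflect (drifted (?\<eta> j) s \<omega>) (real (Suc m))"
            using elim u by (intro reflect_ge) auto
          also have "\<dots> \<le> d * real (Suc m)"
            using m0[OF n(3) s] by (simp add: divide_simps del: of_nat_Suc)
          finally have "s * (B (real (Suc m)) \<omega> - B u \<omega>) \<le> d * real (Suc m) + (1 / real (Suc j)) * (real (Suc m) - u)"
          proof -
            have "s * (x - y) \<le> d * n + a * (n - u)" if "- a * n + s * x - (- a * u + s * y) \<le> d * n" for x y n a
              using that by (simp add: algebra_simps)
            then show "drifted (?\<eta> j) s \<omega> (real (Suc m)) - drifted (?\<eta> j) s \<omega> u \<le> d * real (Suc m) \<Longrightarrow> ?thesis"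
              unfolding drifted_def by blast
          qed
          also have "(1 / real (Suc j)) * (real (Suc m) - u) \<le> d * real (Suc m)"
            using j u d by (intro mult_mono) auto
          finally show ?thesis by simp
        qed
        have "\<bar>B (real (Suc m)) \<omega>\<bar> \<le> 2 * d * real (Suc m)"
          using diff[of 1 0] diff[of "-1" 0] elim by simp
        moreover have "\<bar>B (real (Suc m)) \<omega> - B t \<omega>\<bar> \<le> 2 * d * real (Suc m)"
          using diff[of 1 t] diff[of "-1" t] n t1 by simp
        ultimately have "\<bar>B t \<omega>\<bar> \<le> 4 * d * real (Suc m)" by linarith
        also have "\<dots> \<le> 4 * d * (2 * t)" using n t1 d by (intro mult_left_mono) auto
        finally have "\<bar>B t \<omega>\<bar> / t \<le> 8 * d" using t1 by (simp add: divide_simps)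
        also have "\<dots> < e" using e by (simp add: d_def)
        finally show ?case using t1 by simp
      qed
    qed
  qed
qed

lemma drifted_slope: "AE \<omega> in M. ((\<lambda>t. drifted \<theta> \<sigma> \<omega> t / t) \<longlongrightarrow> \<theta>) at_top"
  using B_sublinear
proof eventually_elim
  case (elim \<omega>)
  have "((\<lambda>t. \<theta> + \<sigma> * (B t \<omega> / t)) \<longlongrightarrow> \<theta> + \<sigma> * 0) at_top" by (intro tendsto_intros elim)
  moreover have "\<forall>\<^sub>F t in at_top. \<theta> + \<sigma> * (B t \<omega> / t) = drifted \<theta> \<sigma> \<omega> t / t"
    using eventually_gt_at_top[of 0] by eventually_elim (simp add: drifted_def field_simps)
  ultimately show ?case using tendsto_cong by force
qed

lemma reflect_mean:
  assumes "\<theta> < 0" "\<sigma> \<noteq> 0"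
  shows "AE \<omega> in M. ((\<lambda>T. integral {0..T} (reflect (drifted \<theta> \<sigma> \<omega>)) / T) \<longlongrightarrow> \<sigma>\<^sup>2 / (- 2 * \<theta>)) at_top"
  using reflect_mean_squares[OF assms] AE_continuous_drifted
proof eventually_elim
  case (elim \<omega>)
  then show ?case
    by (intro mean_tendsto_from_squares continuous_on_reflect reflect_nonneg) auto
qed

end

section \<open>Merging within dyadic epochs\<close>

lemma reflect_over_pow2:
  assumes cont: "continuous_on {0..} l" and lim: "((\<lambda>t. l t / t) \<longlongrightarrow> \<theta>) at_top" and \<theta>: "\<theta> < 0"
  shows "(\<lambda>k. reflect l (epoch k) / 2 ^ k) \<longlonglongrightarrow> 0"
proof (rule tendstoI)
  fix e :: real assume e: "0 < e"
  obtain C where C: "0 \<le> C" "\<And>t. 0 \<le> t \<Longrightarrow> \<bar>l t - \<theta> * t\<bar> \<le> e / 4 * t + C"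
    using linear_growth_bound[OF cont lim, of "e/4"] e by auto
  have "(\<lambda>k. 2 * C / 2 ^ k) \<longlonglongrightarrow> 0" by (intro LIMSEQ_divide_realpow_zero) auto
  then have "\<forall>\<^sub>F k in sequentially. 2 * C / 2 ^ k < e / 2" using e by (intro order_tendstoD) auto
  then show "\<forall>\<^sub>F k in sequentially. dist (reflect l (epoch k) / 2 ^ k) 0 < e"
  proof eventually_elim
    case (elim k)
    have t: "0 \<le> epoch k" "epoch k \<le> 2 ^ k" by (auto simp: epoch_def)
    obtain u where u: "0 \<le> u" "u \<le> epoch k" "reflect l (epoch k) = l (epoch k) - l u"
      using reflect_attained[OF cont t(1)] by auto
    have "\<theta> * epoch k \<le> \<theta> * u" using u \<theta> by (intro mult_left_mono_neg) auto
    moreover have "e / 4 * u \<le> e / 4 * epoch k" using u e by (intro mult_left_mono) auto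
    ultimately have "reflect l (epoch k) \<le> e / 2 * epoch k + 2 * C"
      using C(2)[OF u(1)] C(2)[OF t(1)] u(3) by linarith
    also have "\<dots> \<le> e / 2 * 2 ^ k + 2 * C" using t e by (intro add_mono mult_left_mono) auto
    also have "\<dots> < e * 2 ^ k" using elim by (simp add: divide_simps)
    finally show ?case using reflect_nonneg[OF cont t(1)] by (simp add: divide_simps)
  qed
qed

text \<open>
  An initial height that is negligible compared with the epoch length is used up by the
  negative drift within an arbitrarily small fraction of the epoch.
\<close>

lemma eventually_below_in_epoch:
  assumes cont: "continuous_on {0..} l" and lim: "((\<lambda>t. l t / t) \<longlongrightarrow> \<theta>) at_top" and \<theta>: "\<theta> < 0"
    and p: "(\<lambda>k. p k / 2 ^ k) \<longlonglongrightarrow> (0::real)" and e: "0 < e"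
  shows "\<forall>\<^sub>F k in sequentially. \<forall>t. epoch k + e * 2 ^ k \<le> t \<longrightarrow> t \<le> epoch (Suc k) \<longrightarrow>
    p k + (l t - l (epoch k)) \<le> 0"
proof -
  \<comment> \<open>The drift over a fraction \<open>e\<close> of the epoch is \<open>- 8 * d\<close> times \<open>2 ^ k\<close>; the fluctuations of \<open>l\<close>
    at the two ends use up half of it.\<close>
  define d where "d = - \<theta> * e / 8"
  have d: "0 < d" using \<theta> e by (simp add: d_def mult_neg_pos)
  obtain C where C: "0 \<le> C" "\<And>t. 0 \<le> t \<Longrightarrow> \<bar>l t - \<theta> * t\<bar> \<le> d * t + C"
    using linear_growth_bound[OF cont lim d] by auto
  have "(\<lambda>k. 2 * C / 2 ^ k) \<longlonglongrightarrow> 0" by (intro LIMSEQ_divide_realpow_zero) auto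
  from tendsto_add[OF p this] have "(\<lambda>k. (p k + 2 * C) / 2 ^ k) \<longlonglongrightarrow> 0" by (simp add: add_divide_distrib)
  then have "\<forall>\<^sub>F k in sequentially. (p k + 2 * C) / 2 ^ k < 4 * d" using d by (intro order_tendstoD) auto
  then show ?thesis
  proof (eventually_elim, intro allI impI)
    fix k t assume k: "(p k + 2 * C) / 2 ^ k < 4 * d" and t: "epoch k + e * 2 ^ k \<le> t" "t \<le> epoch (Suc k)"
    have tk: "0 \<le> epoch k" "epoch k \<le> 2 * 2 ^ k" "epoch (Suc k) \<le> 2 * 2 ^ k"
      using one_le_power[of "2::real" k] unfolding epoch_def power_Suc by linarith+
    have "0 \<le> e * 2 ^ k" using e by simp
    then have t0: "0 \<le> t" using t(1) tk(1) by linarith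
    have "\<theta> * t \<le> \<theta> * (epoch k + e * 2 ^ k)" using t \<theta> by (intro mult_left_mono_neg) auto
    moreover have "d * t \<le> d * (2 * 2 ^ k)" "d * epoch k \<le> d * (2 * 2 ^ k)"
      using t tk d by (auto intro!: mult_left_mono)
    ultimately have "l t - l (epoch k) \<le> \<theta> * e * 2 ^ k + 4 * d * 2 ^ k + 2 * C"
      using C(2)[OF t0] C(2)[OF tk(1)] unfolding distrib_left by (simp add: abs_le_iff)
    moreover have "p k + 2 * C < 4 * d * 2 ^ k" using k by (simp add: divide_simps)
    moreover have "\<theta> * e * 2 ^ k + 4 * d * 2 ^ k + 4 * d * 2 ^ k = 0" by (simp add: d_def)
    ultimately show "p k + (l t - l (epoch k)) \<le> 0" by linarith
  qed
qed

lemma epoch_bounds: "0 \<le> epoch k" "epoch k < epoch (Suc k)"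
  by (auto simp: epoch_def)

lemma integral_diff_vanishing_tail:
  fixes f g :: "real \<Rightarrow> real"
  assumes fg: "continuous_on {a..b} f" "continuous_on {a..b} g" and m: "a \<le> m" "m \<le> b"
    and bound: "\<And>t. a \<le> t \<Longrightarrow> t \<le> m \<Longrightarrow> \<bar>f t - g t\<bar> \<le> K"
    and tail: "\<And>t. m \<le> t \<Longrightarrow> t \<le> b \<Longrightarrow> f t = g t"
  shows "\<bar>integral {a..b} f - integral {a..b} g\<bar> \<le> K * (m - a)"
proof -
  have d: "continuous_on {a..b} (\<lambda>t. f t - g t)" by (intro continuous_intros fg)
  have int: "f integrable_on {a..b}" "g integrable_on {a..b}" "(\<lambda>t. f t - g t) integrable_on {a..b}"
    by (intro integrable_continuous_interval fg d)+
  have "integral {a..b} f - integral {a..b} g = integral {a..b} (\<lambda>t. f t - g t)"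
    using int by (simp add: Henstock_Kurzweil_Integration.integral_diff)
  also have "\<dots> = integral {a..m} (\<lambda>t. f t - g t) + integral {m..b} (\<lambda>t. f t - g t)"
    by (rule Henstock_Kurzweil_Integration.integral_combine[symmetric]) (use m int in auto)
  also have "integral {m..b} (\<lambda>t. f t - g t) = integral {m..b} (\<lambda>t. 0)"
    by (rule Henstock_Kurzweil_Integration.integral_cong) (use tail in auto)
  finally have "integral {a..b} f - integral {a..b} g = integral {a..m} (\<lambda>t. f t - g t)" by simp
  moreover have "norm (integral {a..m} (\<lambda>t. f t - g t)) \<le> K * (m - a)"
    by (rule integral_bound) (use m bound in \<open>auto intro: continuous_on_subset[OF d]\<close>)
  ultimately show ?thesis by simp
qed

text \<open>
  In the application \<open>w k\<close> is the distance of the controlled process from the barrier of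
  epoch \<open>k\<close>, and \<open>K\<close> bounds the change of the barrier between epochs. The discrepancy from \<open>reflect l\<close>
  at the start of epoch \<open>k\<close> is at first only known to grow linearly in \<open>k\<close>. That suffices for
  merging within the epoch, which in turn leaves a discrepancy of at most \<open>K\<close> at the start of the
  next one. A bounded discrepancy that disappears within a small fraction of the epoch does not
  affect the average. Finally, the average of \<open>reflect l\<close> over a dyadic epoch tends to
  \<open>2 * c - c\<close>.
\<close>

lemma epoch_mean_tendsto:
  fixes l :: "real \<Rightarrow> real" and w :: "nat \<Rightarrow> real \<Rightarrow> real"
  assumes cont: "continuous_on {0..} l" and lim: "((\<lambda>t. l t / t) \<longlongrightarrow> \<theta>) at_top" and \<theta>: "\<theta> < 0"
    and mean: "((\<lambda>T. integral {0..T} (reflect l) / T) \<longlongrightarrow> c) at_top"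
    and w: "\<And>k. reflected_path l (epoch k) (w k)" and wcont: "\<And>k. continuous_on {epoch k..} (w k)"
    and jump: "\<And>k. \<bar>w (Suc k) (epoch (Suc k)) - w k (epoch (Suc k))\<bar> \<le> K"
  shows "(\<lambda>k. integral {epoch k..epoch (Suc k)} (w k) / 2 ^ k) \<longlonglongrightarrow> c"
proof -
  define R where "R = reflect l"
  have R: "reflected_path l (epoch k) R" for k
    using reflected_path_restart[OF reflected_path_reflect[OF cont] epoch_bounds(1)] by (simp add: R_def)
  have Rcont: "continuous_on {a..b} R" if "0 \<le> a" for a b
    unfolding R_def by (rule continuous_on_subset[OF continuous_on_reflect[OF cont]]) (use that in auto)
  have K: "0 \<le> K" using jump[of 0] by linarith
  define e where "e k = \<bar>w k (epoch k) - R (epoch k)\<bar>" for k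
  have dist: "\<bar>w k t - R t\<bar> \<le> e k" if "epoch k \<le> t" for k t
    using reflected_path_abs_diff_le[OF w R that] by (simp add: e_def)
  have e_Suc: "e (Suc k) \<le> \<bar>w k (epoch (Suc k)) - R (epoch (Suc k))\<bar> + K" for k
    using jump[of k] by (simp add: e_def)
  have e_le: "e k \<le> e 0 + k * K" for k
  proof (induction k)
    case (Suc k)
    have "\<bar>w k (epoch (Suc k)) - R (epoch (Suc k))\<bar> \<le> e k" using epoch_bounds(2)[of k] by (intro dist) simp
    with Suc e_Suc[of k] show ?case by (simp add: algebra_simps)
  qed simp
  have merged: "w k t = R t" if "epoch k \<le> t" "R (epoch k) + p + (l t - l (epoch k)) \<le> 0" "e k \<le> p" for k t p
  proof (rule antisym)
    show "w k t \<le> R t"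
      by (rule reflected_path_le_after_zero[OF w R that(1)]) (use that(2,3) in \<open>simp add: e_def\<close>)
    show "R t \<le> w k t"
      by (rule reflected_path_le_after_zero[OF R w that(1)]) (use that(2,3) in \<open>simp add: e_def\<close>)
  qed
  have Rlim: "(\<lambda>k. R (epoch k) / 2 ^ k) \<longlonglongrightarrow> 0"
    unfolding R_def by (rule reflect_over_pow2[OF cont lim \<theta>])
  have pow: "(\<lambda>k. a / 2 ^ k) \<longlonglongrightarrow> 0" for a :: real
    by (intro LIMSEQ_divide_realpow_zero) auto
  have "(\<lambda>k. R (epoch k) / 2 ^ k + e 0 / 2 ^ k + real k / 2 ^ k * K) \<longlonglongrightarrow> 0 + 0 + 0 * K"
    by (intro tendsto_intros Rlim pow lim_n_over_pown) auto
  then have "(\<lambda>k. (R (epoch k) + (e 0 + k * K)) / 2 ^ k) \<longlonglongrightarrow> 0" by (simp add: add_divide_distrib add.assoc)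
  \<comment> \<open>The initial discrepancy is at most linear in \<open>k\<close>, hence is forgotten within an epoch.\<close>
  from eventually_below_in_epoch[OF cont lim \<theta> this, of 1]
  have "\<forall>\<^sub>F k in sequentially. \<forall>t. epoch k + 2 ^ k \<le> t \<longrightarrow> t \<le> epoch (Suc k) \<longrightarrow>
    R (epoch k) + (e 0 + k * K) + (l t - l (epoch k)) \<le> 0" by simp
  then have "\<forall>\<^sub>F k in sequentially. e (Suc k) \<le> K"
  proof eventually_elim
    case (elim k)
    have "epoch k + 2 ^ k \<le> epoch (Suc k)" by (simp add: epoch_def)
    with elim have "w k (epoch (Suc k)) = R (epoch (Suc k))"
      using epoch_bounds(2)[of k] e_le[of k] by (intro merged[of k _ "e 0 + k * K"]) auto
    then show ?case using e_Suc[of k] by simp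
  qed
  then have e_K: "\<forall>\<^sub>F k in sequentially. e k \<le> K"
    by (simp only: eventually_sequentially_Suc[of "\<lambda>k. e k \<le> K"])
  have RK: "(\<lambda>k. (R (epoch k) + K) / 2 ^ k) \<longlonglongrightarrow> 0"
    using tendsto_add[OF Rlim pow[of K]] by (simp add: add_divide_distrib)
  let ?D = "\<lambda>k. integral {epoch k..epoch (Suc k)} (w k) - integral {epoch k..epoch (Suc k)} R"
  have diff: "(\<lambda>k. ?D k / 2 ^ k) \<longlonglongrightarrow> 0"
  proof (rule tendstoI)
    fix \<epsilon> :: real assume \<epsilon>: "0 < \<epsilon>"
    define d where "d = min 1 (\<epsilon> / (K + 1))"
    have d: "0 < d" "d \<le> 1" "K * d < \<epsilon>"
    proof -
      show "0 < d" "d \<le> 1" using \<epsilon> K by (auto simp: d_def)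
      have "K * d \<le> K * (\<epsilon> / (K + 1))" unfolding d_def using K by (intro mult_left_mono) auto
      also have "\<dots> < \<epsilon>" using K \<epsilon> by (simp add: field_simps)
      finally show "K * d < \<epsilon>" .
    qed
    from eventually_below_in_epoch[OF cont lim \<theta> RK d(1)] e_K
    show "\<forall>\<^sub>F k in sequentially. dist (?D k / 2 ^ k) 0 < \<epsilon>"
    proof eventually_elim
      case (elim k)
      have "\<bar>?D k\<bar> \<le> K * (epoch k + d * 2 ^ k - epoch k)"
      proof (rule integral_diff_vanishing_tail)
        show "continuous_on {epoch k..epoch (Suc k)} (w k)" by (rule continuous_on_subset[OF wcont]) auto
        show "continuous_on {epoch k..epoch (Suc k)} R" by (rule Rcont[OF epoch_bounds(1)])
        show "epoch k \<le> epoch k + d * 2 ^ k" using d by simp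
        have "d * 2 ^ k \<le> 1 * 2 ^ k" using d by (intro mult_right_mono) auto
        then show "epoch k + d * 2 ^ k \<le> epoch (Suc k)" by (simp add: epoch_def)
        show "\<bar>w k t - R t\<bar> \<le> K" if "epoch k \<le> t" for t using dist[OF that] elim by linarith
        show "w k t = R t" if "epoch k + d * 2 ^ k \<le> t" "t \<le> epoch (Suc k)" for t
        proof (rule merged)
          have "0 \<le> d * 2 ^ k" using d by simp
          then show "epoch k \<le> t" using that by linarith
        qed (use elim that in auto)
      qed
      then have "\<bar>?D k\<bar> / 2 ^ k \<le> K * d" by (simp add: divide_simps)
      then show ?case using d(3) by simp
    qed
  qed
  define I where "I T = integral {0..T} R" for T
  have split: "integral {epoch k..epoch (Suc k)} R = I (epoch (Suc k)) - I (epoch k)" for k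
  proof -
    have "integral {0..epoch k} R + integral {epoch k..epoch (Suc k)} R = integral {0..epoch (Suc k)} R"
      by (rule Henstock_Kurzweil_Integration.integral_combine)
        (use epoch_bounds[of k] in \<open>auto intro: integrable_continuous_interval Rcont\<close>)
    then show ?thesis by (simp add: I_def)
  qed
  have elim: "filterlim epoch at_top sequentially"
    unfolding filterlim_at_top
  proof
    fix Z :: real
    show "\<forall>\<^sub>F k in sequentially. Z \<le> epoch k"
      using eventually_ge_at_top[of "nat \<lceil>Z\<rceil>"]
    proof eventually_elim
      case (elim k)
      have "real k + 1 \<le> 2 ^ k" using less_exp[of k] by (metis Suc_leI of_nat_Suc of_nat_le_iff of_nat_numeral of_nat_power add.commute)
      then show ?case using elim unfolding epoch_def by linarith
    qed
  qed
  have A: "(\<lambda>k. I (epoch k) / epoch k) \<longlonglongrightarrow> c"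
    using filterlim_compose[OF mean elim] by (simp add: I_def R_def)
  have "(\<lambda>k. epoch k / 2 ^ k) \<longlonglongrightarrow> 1"
    using tendsto_diff[OF tendsto_const[of 1] pow[of 1]] by (simp add: epoch_def diff_divide_distrib)
  from tendsto_mult[OF A this] have A1: "(\<lambda>k. I (epoch k) / epoch k * (epoch k / 2 ^ k)) \<longlonglongrightarrow> c" by simp
  have A1: "(\<lambda>k. I (epoch k) / 2 ^ k) \<longlonglongrightarrow> c"
  proof (rule Lim_transform_eventually[OF A1])
    show "\<forall>\<^sub>F k in sequentially. I (epoch k) / epoch k * (epoch k / 2 ^ k) = I (epoch k) / 2 ^ k"
      using eventually_gt_at_top[of 0]
    proof eventually_elim
      case (elim k)
      then have "1 < (2::real) ^ k" by (intro one_less_power) auto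
      then show ?case by (simp add: epoch_def)
    qed
  qed
  have "(\<lambda>k. ?D k / 2 ^ k + (2 * (I (epoch (Suc k)) / 2 ^ Suc k) - I (epoch k) / 2 ^ k)) \<longlonglongrightarrow> 0 + (2 * c - c)"
    by (intro tendsto_intros diff A1 LIMSEQ_Suc[OF A1])
  then show ?thesis by (simp add: split diff_divide_distrib)
qed

lemma dyadic_weighted_mean_tendsto:
  fixes b :: "nat \<Rightarrow> real"
  assumes b: "b \<longlonglongrightarrow> c"
  shows "(\<lambda>k. (\<Sum>i=0..k. 2 ^ i * b i) / epoch (Suc k)) \<longlonglongrightarrow> c"
proof (rule tendstoI)
  fix e :: real assume e: "0 < e"
  obtain n where n: "\<And>i. n \<le> i \<Longrightarrow> \<bar>b i - c\<bar> < e / 2"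
    using tendstoD[OF b, of "e/2"] e by (auto simp: eventually_sequentially dist_real_def)
  define A where "A = (\<Sum>i<n. 2 ^ i * \<bar>b i - c\<bar>)"
  have A: "0 \<le> A" unfolding A_def by (intro sum_nonneg) auto
  have geo: "(\<Sum>i=0..k. 2 ^ i) = epoch (Suc k)" for k
    by (induction k) (auto simp: epoch_def)
  have bound: "(\<Sum>i=0..k. 2 ^ i * \<bar>b i - c\<bar>) \<le> A + e / 2 * epoch (Suc k)" for k
  proof -
    have "(\<Sum>i=0..k. 2 ^ i * \<bar>b i - c\<bar>) \<le> (\<Sum>i=0..k. (if i < n then 2 ^ i * \<bar>b i - c\<bar> else 0) + 2 ^ i * (e / 2))"
    proof (rule sum_mono)
      fix i
      show "2 ^ i * \<bar>b i - c\<bar> \<le> (if i < n then 2 ^ i * \<bar>b i - c\<bar> else 0) + 2 ^ i * (e / 2)"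
        using n[of i] e by (auto intro!: mult_left_mono)
    qed
    also have "\<dots> = (\<Sum>i\<in>{0..k} \<inter> {..<n}. 2 ^ i * \<bar>b i - c\<bar>) + epoch (Suc k) * (e / 2)"
      unfolding sum.distrib sum_distrib_right[symmetric] geo
      by (simp add: sum.If_cases lessThan_def)
    also have "\<dots> \<le> A + epoch (Suc k) * (e / 2)"
      unfolding A_def by (intro add_right_mono sum_mono2) auto
    finally show ?thesis by (simp add: mult.commute)
  qed
  have "(\<lambda>k. 2 * A / 2 ^ k) \<longlonglongrightarrow> 0" by (intro LIMSEQ_divide_realpow_zero) auto
  then have "\<forall>\<^sub>F k in sequentially. 2 * A / 2 ^ k < e" using e by (intro order_tendstoD) auto
  then show "\<forall>\<^sub>F k in sequentially. dist ((\<Sum>i=0..k. 2 ^ i * b i) / epoch (Suc k)) c < e"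
  proof eventually_elim
    case (elim k)
    have ep: "2 ^ k \<le> epoch (Suc k)" using one_le_power[of "2::real" k] by (simp add: epoch_def)
    have pos: "0 < epoch (Suc k)" using epoch_bounds(1,2)[of k] by linarith
    have "(\<Sum>i=0..k. 2 ^ i * b i) - c * epoch (Suc k) = (\<Sum>i=0..k. 2 ^ i * (b i - c))"
      unfolding geo[symmetric] by (simp add: algebra_simps sum_subtractf sum_distrib_left)
    then have "\<bar>(\<Sum>i=0..k. 2 ^ i * b i) - c * epoch (Suc k)\<bar> \<le> (\<Sum>i=0..k. 2 ^ i * \<bar>b i - c\<bar>)"
      using sum_abs[of "\<lambda>i. 2 ^ i * (b i - c)" "{0..k}"] by (simp add: abs_mult)
    also have "\<dots> \<le> A + e / 2 * epoch (Suc k)" by (rule bound)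
    also have "\<dots> < e / 2 * 2 ^ k + e / 2 * epoch (Suc k)" using elim by (simp add: divide_simps)
    also have "\<dots> \<le> e * epoch (Suc k)" using mult_left_mono[OF ep, of e] e by linarith
    finally have "\<bar>(\<Sum>i=0..k. 2 ^ i * b i) - c * epoch (Suc k)\<bar> / epoch (Suc k) < e"
      using pos by (simp add: divide_simps)
    moreover have "(\<Sum>i=0..k. 2 ^ i * b i) / epoch (Suc k) - c = ((\<Sum>i=0..k. 2 ^ i * b i) - c * epoch (Suc k)) / epoch (Suc k)"
      using pos by (simp add: diff_divide_distrib)
    ultimately show ?case using pos by (simp add: dist_real_def)
  qed
qed


section \<open>Boundedness of the optimal barrier\<close>

lemma admissible_costD:
  assumes "admissible_cost glow h"
  shows "\<And>x. 0 \<le> h x" "continuous_on UNIV h" "filterlim h at_top at_bot"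
    "\<And>x y. 0 \<le> x \<Longrightarrow> x < y \<Longrightarrow> h x < h y" "\<And>x y. x < y \<Longrightarrow> y \<le> 0 \<Longrightarrow> h y < h x"
proof -
  show "\<And>x. 0 \<le> h x" and cont: "continuous_on UNIV h" and "filterlim h at_top at_bot"
    using assms by (auto simp: admissible_cost_def)
  show "h x < h y" if "0 \<le> x" "x < y" for x y
    using assms that strict_mono_onD[of "{0..}" h x y] by (auto simp: admissible_cost_def)
  show "h y < h x" if "x < y" "y \<le> 0" for x y
  proof (rule DERIV_neg_imp_decreasing_open[OF that(1)])
    fix z assume "x < z" "z < y"
    then have z: "z < 0" using that by simp
    then have "h differentiable (at z)" "deriv h z < 0" using assms by (auto simp: admissible_cost_def)
    then show "\<exists>D. (h has_real_derivative D) (at z) \<and> D < 0"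
      using DERIV_deriv_iff_real_differentiable by blast
  qed (rule continuous_on_subset[OF cont], simp)
qed

text \<open>
  The growth condition holds only near infinity; monotonicity extends it to the half-line.
\<close>

lemma admissible_cost_exp_bound:
  assumes "admissible_cost glow h"
  obtains A b where "0 \<le> A" "0 < b" "b < glow / 2" "\<And>z. 0 \<le> z \<Longrightarrow> h z \<le> A * exp (b * z)"
proof -
  note h = admissible_costD[OF assms]
  obtain b where b: "0 < b" "b < glow / 2" "Limsup at_top (\<lambda>x. ereal (h x / exp (b * x))) < \<infinity>"
    using assms by (auto simp: admissible_cost_def)
  then obtain n :: nat where "Limsup at_top (\<lambda>x. ereal (h x / exp (b * x))) < ereal (real n)"
    using less_PInf_Ex_of_nat by auto
  then obtain C :: real where "Limsup at_top (\<lambda>x. ereal (h x / exp (b * x))) < ereal C"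
    by blast
  then have "\<forall>\<^sub>F x in at_top. ereal (h x / exp (b * x)) < ereal C" by (rule Limsup_lessD)
  then obtain N where N: "\<And>x. N \<le> x \<Longrightarrow> h x / exp (b * x) < C" by (auto simp: eventually_at_top_linorder)
  define n where "n = max N 0"
  define A where "A = max C (h n)"
  show ?thesis
  proof
    show "0 \<le> A" using h(1)[of n] by (simp add: A_def)
    show "h z \<le> A * exp (b * z)" if z: "0 \<le> z" for z
    proof (cases "n \<le> z")
      case True
      then have "h z / exp (b * z) < C" by (intro N) (simp add: n_def)
      then have "h z \<le> C * exp (b * z)" by (simp add: divide_simps)
      also have "\<dots> \<le> A * exp (b * z)" by (intro mult_right_mono) (auto simp: A_def)
      finally show ?thesis .
    next
      case False
      then have "h z \<le> h n" using h(4)[of z n] z by simp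
      also have "\<dots> \<le> A * exp (b * z)"
        using mult_mono[of "h n" A 1 "exp (b * z)"] h(1)[of n] b z by (simp add: A_def)
      finally show ?thesis .
    qed
  qed (use b in auto)
qed

lemma has_bochner_integral_exp_tail:
  fixes c r :: real assumes "0 < c"
  shows "has_bochner_integral lborel (\<lambda>z. indicator {r..} z *\<^sub>R exp (- c * z)) (exp (- c * r) / c)"
proof (rule has_bochner_integral_nn_integral)
  have lim: "((\<lambda>z. - exp (- c * z) / c) \<longlongrightarrow> - 0 / c) at_top"
    using assms
    by (intro tendsto_intros filterlim_compose[OF exp_at_bot] filterlim_tendsto_neg_mult_at_bot[OF tendsto_const])
      (auto simp: filterlim_ident)
  have "(\<integral>\<^sup>+z. ennreal (exp (- c * z)) * indicator {r..} z \<partial>lborel) = ennreal (- 0 / c - (- exp (- c * r) / c))"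
    by (rule nn_integral_FTC_atLeast[OF _ _ _ lim]) (use assms in \<open>auto intro!: derivative_eq_intros\<close>)
  moreover have "ennreal (indicator {r..} z *\<^sub>R exp (- c * z)) = ennreal (exp (- c * z)) * indicator {r..} z" for z
    by (simp split: split_indicator)
  ultimately show "(\<integral>\<^sup>+z. ennreal (indicator {r..} z *\<^sub>R exp (- c * z)) \<partial>lborel) = ennreal (exp (- c * r) / c)"
    by simp
qed (use assms in auto)

lemma exp_tail_set_integral:
  fixes c r :: real assumes "0 < c"
  shows "set_integrable lborel {r..} (\<lambda>z. exp (- c * z))" "(LINT z:{r..}|lborel. exp (- c * z)) = exp (- c * r) / c"
  using has_bochner_integral_exp_tail[OF assms, of r]
  unfolding set_integrable_def set_lebesgue_integral_def by (auto simp: has_bochner_integral_iff)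

lemma set_integral_atLeast_split:
  fixes f :: "real \<Rightarrow> real"
  assumes "set_integrable lborel {a..} f" "a \<le> b"
  shows "(LINT z:{a..}|lborel. f z) = (LINT z:{a..<b}|lborel. f z) + (LINT z:{b..}|lborel. f z)"
proof -
  have "{a..} = {a..<b} \<union> {b..}" "{a..<b} \<inter> {b..} = {}" using assms(2) by auto
  moreover have "set_integrable lborel {a..<b} f" "set_integrable lborel {b..} f"
    using assms by (auto intro: set_integrable_subset)
  ultimately show ?thesis using set_integral_Un[of "{a..<b}" "{b..}" lborel f] by simp
qed

context
  fixes h :: "real \<Rightarrow> real" and glow u A b :: real
  assumes adm: "admissible_cost glow h" and glow: "0 < glow" and u: "glow \<le> u"
    and A: "0 \<le> A" and b: "0 < b" "b < glow / 2" and hA: "\<And>z. 0 \<le> z \<Longrightarrow> h z \<le> A * exp (b * z)"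
begin

abbreviation (input) tail_cost :: "real \<Rightarrow> real" where
  "tail_cost r \<equiv> LINT z:{r..}|lborel. h z * exp (- u * z)"

lemma u_pos: "0 < u" using glow u by simp

lemma cost_measurable: "h \<in> borel_measurable borel"
  using admissible_costD(2)[OF adm] by (rule borel_measurable_continuous_onI)

lemma discounted_cost_integrable: "set_integrable lborel {r..} (\<lambda>z. h z * exp (- u * z))"
proof -
  note [measurable] = cost_measurable
  have "set_integrable lborel {0..} (\<lambda>z. A * exp (- (u - b) * z))"
    using exp_tail_set_integral(1)[of "u - b" 0] b u glow by (auto intro: set_integrable_mult_right)
  then have pos: "set_integrable lborel {0..} (\<lambda>z. h z * exp (- u * z))"
  proof (rule set_integrable_bound)
    show "set_borel_measurable lborel {0..} (\<lambda>z. h z * exp (- u * z))"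
      unfolding set_borel_measurable_def by measurable
    have "h z * exp (- u * z) \<le> A * exp (- (u - b) * z)" if "0 \<le> z" for z
      using mult_right_mono[OF hA[OF that], of "exp (- u * z)"]
      by (simp add: exp_add[symmetric] mult.assoc algebra_simps)
    then show "AE z in lborel. z \<in> {0..} \<longrightarrow> norm (h z * exp (- u * z)) \<le> norm (A * exp (- (u - b) * z))"
      using admissible_costD(1)[OF adm] A by auto
  qed
  have "set_integrable lborel {min r 0..0} (\<lambda>z. h z * exp (- u * z))"
    by (intro borel_integrable_atLeastAtMost' continuous_intros continuous_on_subset[OF admissible_costD(2)[OF adm]]) auto
  from set_integrable_Un[OF this pos] show ?thesis
    by (rule set_integrable_subset) auto
qed

lemma cost_C_eq: "cost_C h u r = u * exp (u * r) * tail_cost r"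
proof -
  have "(LINT z:{r..}|lborel. h z * exp (- u * (z - r))) = (LINT z:{r..}|lborel. exp (u * r) * (h z * exp (- u * z)))"
    by (intro set_lebesgue_integral_cong) (auto simp: exp_add[symmetric] exp_diff exp_minus field_simps)
  then show ?thesis unfolding cost_C_def by simp
qed

text \<open>
  The factor \<open>exp (- u * r)\<close> removes the dependence of the integrand of \<open>cost_F\<close> on \<open>r\<close> and
  makes the function monotone to the left of zero.
\<close>

definition scaled_F :: "real \<Rightarrow> real" where
  "scaled_F r = u * tail_cost r - h r * exp (- u * r)"

lemma cost_F_eq: "cost_F h u r = exp (u * r) * scaled_F r"
  unfolding cost_F_def cost_C_eq scaled_F_def
  by (simp add: right_diff_distrib exp_minus field_simps)

text \<open>
  On \<open>{r1..r2}\<close> the cost is at most \<open>h r1\<close>, as \<open>h\<close> decreases to the left of zero.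
\<close>

lemma tail_cost_diff:
  assumes r: "r1 \<le> r2" "r2 \<le> 0"
  shows "0 \<le> tail_cost r1 - tail_cost r2"
    and "u * (tail_cost r1 - tail_cost r2) \<le> h r1 * (exp (- u * r1) - exp (- u * r2))"
proof -
  note split = set_integral_atLeast_split[OF discounted_cost_integrable r(1)]
  note esplit = set_integral_atLeast_split[OF exp_tail_set_integral(1)[OF u_pos] r(1)]
  have int: "set_integrable lborel {r1..<r2} (\<lambda>z. h z * exp (- u * z))"
    by (rule set_integrable_subset[OF discounted_cost_integrable[of r1]]) auto
  have eint: "set_integrable lborel {r1..<r2} (\<lambda>z. exp (- u * z))"
    by (rule set_integrable_subset[OF exp_tail_set_integral(1)[OF u_pos, of r1]]) auto
  have "0 \<le> (LINT z:{r1..<r2}|lborel. h z * exp (- u * z))"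
    unfolding set_lebesgue_integral_def using admissible_costD(1)[OF adm]
    by (intro Bochner_Integration.integral_nonneg) (auto simp: indicator_def)
  then show "0 \<le> tail_cost r1 - tail_cost r2" using split by simp
  have "(LINT z:{r1..<r2}|lborel. h z * exp (- u * z)) \<le> (LINT z:{r1..<r2}|lborel. h r1 * exp (- u * z))"
  proof (rule set_integral_mono[OF int])
    show "set_integrable lborel {r1..<r2} (\<lambda>z. h r1 * exp (- u * z))"
      using eint by (intro set_integrable_mult_right) auto
    fix z assume z: "z \<in> {r1..<r2}"
    then have "h z \<le> h r1" using admissible_costD(5)[OF adm, of r1 z] r by (cases "z = r1") auto
    then show "h z * exp (- u * z) \<le> h r1 * exp (- u * z)" by simp
  qed
  also have "\<dots> = h r1 * ((exp (- u * r1) - exp (- u * r2)) / u)"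
    using esplit exp_tail_set_integral(2)[OF u_pos] by (simp add: diff_divide_distrib)
  finally have "tail_cost r1 - tail_cost r2 \<le> h r1 * ((exp (- u * r1) - exp (- u * r2)) / u)" using split by simp
  then show "u * (tail_cost r1 - tail_cost r2) \<le> h r1 * (exp (- u * r1) - exp (- u * r2))"
    using u_pos by (simp add: field_simps)
qed

lemma scaled_F_diff:
  assumes r: "r1 \<le> r2" "r2 \<le> 0"
  shows "scaled_F r1 \<le> scaled_F r2 - exp (- u * r2) * (h r1 - h r2)"
  using tail_cost_diff(2)[OF r] unfolding scaled_F_def by (simp add: algebra_simps)

lemma scaled_F_strict_mono:
  assumes "r1 < r2" "r2 \<le> 0"
  shows "scaled_F r1 < scaled_F r2"
proof -
  have "0 < exp (- u * r2) * (h r1 - h r2)" using admissible_costD(5)[OF adm assms] by simp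
  then show ?thesis using scaled_F_diff[of r1 r2] assms by simp
qed

text \<open>
  To the right of zero \<open>h\<close> increases, so the discounted cost exceeds its value for the
  constant \<open>h r\<close>; strictness comes from replacing \<open>h\<close> by \<open>h (r + 1)\<close> beyond \<open>r + 1\<close>.
\<close>

lemma scaled_F_pos:
  assumes r: "0 \<le> r"
  shows "0 < scaled_F r"
proof -
  have low: "h s * exp (- u * s) \<le> u * tail_cost s" if "0 \<le> s" for s
  proof -
    have "(LINT z:{s..}|lborel. h s * exp (- u * z)) \<le> tail_cost s"
    proof (rule set_integral_mono[OF _ discounted_cost_integrable])
      show "set_integrable lborel {s..} (\<lambda>z. h s * exp (- u * z))"
        using exp_tail_set_integral(1)[OF u_pos] by (intro set_integrable_mult_right) auto
      fix z assume z: "z \<in> {s..}"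
      then have "h s \<le> h z" using admissible_costD(4)[OF adm, of s z] that by (cases "z = s") auto
      then show "h s * exp (- u * z) \<le> h z * exp (- u * z)" by simp
    qed
    moreover have "(LINT z:{s..}|lborel. h s * exp (- u * z)) = h s * (exp (- u * s) / u)"
      using exp_tail_set_integral(2)[OF u_pos] by simp
    ultimately have "h s * (exp (- u * s) / u) \<le> tail_cost s" by (simp only:)
    from mult_left_mono[OF this, of u] show ?thesis using u_pos by simp
  qed
  note split = set_integral_atLeast_split[OF discounted_cost_integrable, of r "r + 1"]
  note esplit = set_integral_atLeast_split[OF exp_tail_set_integral(1)[OF u_pos], of r "r + 1"]
  have int: "set_integrable lborel {r..<r+1} (\<lambda>z. h z * exp (- u * z))"
    by (rule set_integrable_subset[OF discounted_cost_integrable[of r]]) auto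
  have eint: "set_integrable lborel {r..<r+1} (\<lambda>z. exp (- u * z))"
    by (rule set_integrable_subset[OF exp_tail_set_integral(1)[OF u_pos, of r]]) auto
  have "(LINT z:{r..<r+1}|lborel. h r * exp (- u * z)) \<le> (LINT z:{r..<r+1}|lborel. h z * exp (- u * z))"
  proof (rule set_integral_mono[OF _ int])
    show "set_integrable lborel {r..<r+1} (\<lambda>z. h r * exp (- u * z))"
      using eint by (intro set_integrable_mult_right) auto
    fix z assume z: "z \<in> {r..<r+1}"
    then have "h r \<le> h z" using admissible_costD(4)[OF adm, of r z] r by (cases "z = r") auto
    then show "h r * exp (- u * z) \<le> h z * exp (- u * z)" by simp
  qed
  moreover have "(LINT z:{r..<r+1}|lborel. h r * exp (- u * z)) = h r * ((exp (- u * r) - exp (- u * (r + 1))) / u)"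
    using esplit exp_tail_set_integral(2)[OF u_pos] by (simp add: diff_divide_distrib)
  ultimately have "h r * ((exp (- u * r) - exp (- u * (r + 1))) / u) \<le> (LINT z:{r..<r+1}|lborel. h z * exp (- u * z))"
    by (simp only:)
  from mult_left_mono[OF this, of u]
  have "h r * (exp (- u * r) - exp (- u * (r + 1))) \<le> u * (LINT z:{r..<r+1}|lborel. h z * exp (- u * z))"
    using u_pos by simp
  moreover have "h r * exp (- u * (r + 1)) < h (r + 1) * exp (- u * (r + 1))"
    using admissible_costD(4)[OF adm r, of "r + 1"] by (intro mult_strict_right_mono) auto
  moreover have "h (r + 1) * exp (- u * (r + 1)) \<le> u * tail_cost (r + 1)"
    using r by (intro low) simp
  moreover have "u * tail_cost r = u * (LINT z:{r..<r+1}|lborel. h z * exp (- u * z)) + u * tail_cost (r + 1)"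
    using split by (simp add: distrib_left)
  ultimately show ?thesis unfolding scaled_F_def right_diff_distrib by linarith
qed

text \<open>
  The constant 2 bounds \<open>u / (u - b)\<close>, since \<open>b\<close> is less than \<open>u / 2\<close>.
\<close>

lemma tail_cost_0_le: "u * tail_cost 0 \<le> 2 * A"
proof -
  have ub: "0 < u - b" using b u glow by simp
  have "tail_cost 0 \<le> (LINT z:{0..}|lborel. A * exp (- (u - b) * z))"
  proof (rule set_integral_mono[OF discounted_cost_integrable])
    show "set_integrable lborel {0..} (\<lambda>z. A * exp (- (u - b) * z))"
      using exp_tail_set_integral(1)[OF ub] by (intro set_integrable_mult_right) auto
    fix z :: real assume "z \<in> {0..}"
    then show "h z * exp (- u * z) \<le> A * exp (- (u - b) * z)"
      using mult_right_mono[OF hA, of z "exp (- u * z)"]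
      by (simp add: exp_add[symmetric] mult.assoc algebra_simps)
  qed
  also have "\<dots> = A / (u - b)" using exp_tail_set_integral(2)[OF ub, of 0] by simp
  finally have "u * tail_cost 0 \<le> u * (A / (u - b))" using u_pos by (intro mult_left_mono) auto
  also have "\<dots> = A * (u / (u - b))" by simp
  also have "\<dots> \<le> A * 2" using ub b u A by (intro mult_left_mono) (auto simp: divide_simps)
  finally show ?thesis by simp
qed

lemma scaled_F_neg:
  assumes "r \<le> 0" "2 * A < h r"
  shows "scaled_F r < 0"
  using scaled_F_diff[of r 0] assms tail_cost_0_le by (simp add: scaled_F_def)

lemma scaled_F_continuous: "continuous_on {a..0} scaled_F"
proof -
  have "continuous_on {a..0} tail_cost"
    unfolding continuous_on_def
  proof
    fix r assume r: "r \<in> {a..0}"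
    have le: "\<bar>tail_cost s - tail_cost r\<bar> \<le> h a / u * \<bar>exp (- u * s) - exp (- u * r)\<bar>" if s: "s \<in> {a..0}" for s
    proof -
      have aux: "\<bar>tail_cost p - tail_cost q\<bar> \<le> h a / u * \<bar>exp (- u * p) - exp (- u * q)\<bar>"
        if pq: "a \<le> p" "p \<le> q" "q \<le> 0" for p q
      proof -
        have "h p \<le> h a" using admissible_costD(5)[OF adm, of a p] pq by (cases "p = a") auto
        moreover have e: "0 \<le> exp (- u * p) - exp (- u * q)" using pq u_pos by simp
        ultimately have "u * (tail_cost p - tail_cost q) \<le> h a * (exp (- u * p) - exp (- u * q))"
          using tail_cost_diff(2)[OF pq(2,3)] mult_right_mono[of "h p" "h a"] by (meson order_trans)
        then have "tail_cost p - tail_cost q \<le> h a / u * (exp (- u * p) - exp (- u * q))"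
          using u_pos by (simp add: field_simps)
        then show ?thesis using tail_cost_diff(1)[OF pq(2,3)] e by simp
      qed
      show ?thesis using aux[of s r] aux[of r s] r s by (cases "s \<le> r") (auto simp: abs_minus_commute)
    qed
    have "((\<lambda>s. h a / u * \<bar>exp (- u * s) - exp (- u * r)\<bar>) \<longlongrightarrow> h a / u * \<bar>exp (- u * r) - exp (- u * r)\<bar>) (at r within {a..0})"
      by (intro tendsto_intros)
    then have lim: "((\<lambda>s. h a / u * \<bar>exp (- u * s) - exp (- u * r)\<bar>) \<longlongrightarrow> 0) (at r within {a..0})" by simp
    have "((\<lambda>s. tail_cost s - tail_cost r) \<longlongrightarrow> 0) (at r within {a..0})"
      by (rule Lim_null_comparison[OF _ lim]) (use le in \<open>auto simp: eventually_at_filter\<close>)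
    then show "(tail_cost \<longlongrightarrow> tail_cost r) (at r within {a..0})" by (simp add: LIM_zero_iff)
  qed
  then show ?thesis unfolding scaled_F_def[abs_def]
    by (intro continuous_intros continuous_on_subset[OF admissible_costD(2)[OF adm]]) auto
qed

text \<open>
  A unique zero exists because \<open>scaled_F\<close> is negative at \<open>- K\<close>, strictly increasing up to
  zero and positive from there on.
\<close>

lemma barrier_range:
  assumes K: "0 \<le> K" "2 * A < h (- K)"
  shows "barrier h u \<in> {- K..0}"
proof -
  have neg: "scaled_F (- K) < 0" using scaled_F_neg[of "- K"] K by simp
  have zero: "cost_F h u r = 0 \<longleftrightarrow> scaled_F r = 0" for r by (simp add: cost_F_eq)
  obtain r where r: "- K \<le> r" "r \<le> 0" "scaled_F r = 0"
    using IVT'[of scaled_F "- K" 0 0] scaled_F_continuous[of "- K"] neg scaled_F_pos[of 0] K by auto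
  have "barrier h u = r"
    unfolding barrier_def zero
  proof (rule the_equality[where a=r])
    fix s assume s: "scaled_F s = 0"
    then have "s \<le> 0" using scaled_F_pos[of s] by force
    then show "s = r" using scaled_F_strict_mono[of s r] scaled_F_strict_mono[of r s] r s
      by (cases s r rule: linorder_cases) auto
  qed (rule r)
  with r show ?thesis by simp
qed

end

lemma barrier_bounded:
  assumes "admissible_cost glow h" "0 < glow"
  obtains K where "0 \<le> K" "\<And>u. glow \<le> u \<Longrightarrow> barrier h u \<in> {- K..0}"
proof -
  obtain A b where A: "0 \<le> A" "0 < b" "b < glow / 2" "\<And>z. 0 \<le> z \<Longrightarrow> h z \<le> A * exp (b * z)"
    using admissible_cost_exp_bound[OF assms(1)] by blast
  have "\<forall>\<^sub>F x in at_bot. 2 * A < h x"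
    using admissible_costD(3)[OF assms(1)] by (auto simp: filterlim_at_top_dense)
  then obtain N where N: "\<And>x. x \<le> N \<Longrightarrow> 2 * A < h x" by (auto simp: eventually_at_bot_linorder)
  show ?thesis
  proof
    show "0 \<le> max 0 (- N)" by simp
    show "barrier h u \<in> {- max 0 (- N)..0}" if "glow \<le> u" for u
      by (rule barrier_range[OF assms that A]) (auto intro!: N)
  qed
qed


section \<open>Consistency of the estimators\<close>

lemma Lim_at_left_eq:
  fixes f g :: "real \<Rightarrow> real"
  assumes "a < b" "continuous_on {a..} g" "\<And>t. t \<in> {a..<b} \<Longrightarrow> f t = g t"
  shows "Lim (at_left b) f = g b"
proof (rule tendsto_Lim)
  have "(g \<longlongrightarrow> g b) (at b within {a..})"
    using assms(1,2) by (auto simp: continuous_on_def)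
  then have "(g \<longlongrightarrow> g b) (at_left b)"
    using assms(1) by (subst at_within_Icc_at_left[symmetric, OF assms(1)], elim tendsto_within_subset) auto
  moreover have "\<forall>\<^sub>F t in at_left b. g t = f t"
    using eventually_at_left_real[OF assms(1)] by eventually_elim (use assms(3) in auto)
  ultimately show "(f \<longlongrightarrow> g b) (at_left b)" by (rule Lim_transform_eventually)
qed simp

lemma set_integral_eq_off_endpoint:
  fixes f g :: "real \<Rightarrow> real"
  assumes g: "continuous_on {a..b} g" and eq: "\<And>t. t \<in> {a..<b} \<Longrightarrow> f t = g t"
  shows "(LINT t:{a..b}|lborel. f t) = integral {a..b} g"
proof -
  have "(LINT t:{a..b}|lborel. f t) = (LINT t:{a..b}|lborel. g t)"
    unfolding set_lebesgue_integral_def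
    by (rule integral_discrete_difference[of "{b}"]) (use eq in \<open>auto simp: indicator_def\<close>)
  also have "\<dots> = integral {a..b} g"
    by (rule set_borel_integral_eq_integral[OF borel_integrable_atLeastAtMost'[OF g]])
  finally show ?thesis .
qed

text \<open>
  The drift makes the free path from \<open>w 0\<close> negative from some time on, after which \<open>w\<close> and
  \<open>reflect l\<close> coincide.
\<close>

lemma reflected_path_mean_tendsto:
  assumes cont: "continuous_on {0..} l" and lim: "((\<lambda>t. l t / t) \<longlongrightarrow> \<theta>) at_top" and \<theta>: "\<theta> < 0"
    and mean: "((\<lambda>T. integral {0..T} (reflect l) / T) \<longlongrightarrow> c) at_top"
    and w: "reflected_path l 0 w" and wcont: "continuous_on {0..} w"
  shows "((\<lambda>T. integral {0..T} w / T) \<longlongrightarrow> c) at_top"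
proof -
  note R = reflected_path_reflect[OF cont]
  have R0: "reflect l 0 = 0" by (simp add: reflect_def)
  have w0: "0 \<le> w 0" using w unfolding reflected_path_def by simp
  have "\<forall>\<^sub>F t in at_top. l t / t < \<theta> / 2" using lim \<theta> by (intro order_tendstoD) auto
  moreover have "\<forall>\<^sub>F t in at_top. max 1 ((w 0 - l 0) / (- \<theta> / 2)) \<le> t" by (rule eventually_ge_at_top)
  ultimately have "\<forall>\<^sub>F t in at_top. 0 \<le> t \<and> w 0 + (l t - l 0) \<le> 0"
  proof eventually_elim
    case (elim t)
    then have "l t < \<theta> / 2 * t" "w 0 - l 0 \<le> - \<theta> / 2 * t" using \<theta> by (auto simp: divide_simps mult.commute)
    then show ?case using elim by auto
  qed
  then obtain m where m: "\<And>t. m \<le> t \<Longrightarrow> 0 \<le> t \<and> w 0 + (l t - l 0) \<le> 0" by (auto simp: eventually_at_top_linorder)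
  have eq: "w t = reflect l t" if "m \<le> t" for t
    using m[OF that] w0 R0
    by (intro antisym reflected_path_le_after_zero[OF w R] reflected_path_le_after_zero[OF R w]) auto
  have bound: "\<bar>w t - reflect l t\<bar> \<le> w 0" if "0 \<le> t" for t
    using reflected_path_abs_diff_le[OF w R that] R0 w0 by simp
  let ?D = "\<lambda>T. integral {0..T} w - integral {0..T} (reflect l)"
  have zero: "((\<lambda>T. w 0 * (m - 0) / T) \<longlongrightarrow> 0) at_top"
    by (rule real_tendsto_divide_at_top[OF tendsto_const filterlim_ident])
  have le: "\<forall>\<^sub>F T in at_top. norm (?D T / T) \<le> w 0 * (m - 0) / T"
    using eventually_ge_at_top[of "max m 1"]
  proof eventually_elim
    case (elim T)
    have "\<bar>?D T\<bar> \<le> w 0 * (m - 0)"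
      by (rule integral_diff_vanishing_tail)
        (use elim m[of m] eq bound in \<open>auto intro: continuous_on_subset[OF wcont] continuous_on_subset[OF continuous_on_reflect[OF cont]]\<close>)
    then show ?case using elim by (simp add: divide_right_mono)
  qed
  from tendsto_add[OF Lim_null_comparison[OF le zero] mean] show ?thesis by (simp add: diff_divide_distrib)
qed

context brownian
begin

lemma reflected_bm_path:
  assumes "reflected_bm M F B \<theta> \<sigma> s r y Z Y"
  shows "AE \<omega> in M. reflected_path (drifted \<theta> \<sigma> \<omega>) s (\<lambda>t. Z t \<omega> - r \<omega>) \<and>
    continuous_on {s..} (\<lambda>t. Z t \<omega>) \<and> Z s \<omega> = y \<omega>"
proof -
  from assms have "AE \<omega> in M.
        r \<omega> \<le> y \<omega> \<and>
        continuous_on {s..} (\<lambda>t. Z t \<omega>) \<and>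
        continuous_on {s..} (\<lambda>t. Y t \<omega>) \<and>
        (\<forall>t\<ge>s. Z t \<omega> = y \<omega> + \<theta> * (t - s) + \<sigma> * (B t \<omega> - B s \<omega>) + Y t \<omega>) \<and>
        (\<forall>t\<ge>s. r \<omega> \<le> Z t \<omega>) \<and>
        mono_on {s..} (\<lambda>t. Y t \<omega>) \<and>
        Y s \<omega> = 0 \<and>
        (\<forall>t\<ge>s. (\<integral>\<^sup>+ u \<in> {s..t}. indicator {v. r \<omega> < Z v \<omega>} u
                   \<partial>interval_measure (\<lambda>v. Y (max s v) \<omega>)) = 0)"
    unfolding reflected_bm_def by blast
  then show ?thesis
  proof eventually_elim
    case (elim \<omega>)
    have "Z t \<omega> = y \<omega> + (drifted \<theta> \<sigma> \<omega> t - drifted \<theta> \<sigma> \<omega> s) + Y t \<omega>" if "s \<le> t" for t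
      using elim that by (simp add: drifted_def algebra_simps)
    then have "reflected_path (drifted \<theta> \<sigma> \<omega>) s (\<lambda>t. Z t \<omega> - r \<omega>)"
      using elim by (intro skorokhod_reflected_path[where y="y \<omega>" and Y="\<lambda>t. Y t \<omega>"]) auto
    then show ?case using elim by auto
  qed
qed

lemma LTO_consistent:
  assumes \<theta>: "\<theta> < 0" and \<sigma>: "0 < \<sigma>" and \<gamma>: "\<gamma> = - 2 * \<theta> / \<sigma>\<^sup>2" and low: "\<gamma>low \<le> \<gamma>"
    and Z: "reflected_bm M F B \<theta> \<sigma> 0 (\<lambda>_. 0) (\<lambda>_. x) Z Y"
  shows "AE \<omega> in M. ((\<lambda>\<tau>. LTO_estimator \<gamma>low (\<lambda>t. Z t \<omega>) \<tau>) \<longlongrightarrow> \<gamma>) at_top"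
proof -
  have s0: "\<sigma> \<noteq> 0" using \<sigma> by simp
  show ?thesis
    using reflected_bm_path[OF Z] AE_continuous_drifted drifted_slope[of \<theta> \<sigma>] reflect_mean[OF \<theta> s0]
  proof eventually_elim
    case (elim \<omega>)
    define c where "c = \<sigma>\<^sup>2 / (- 2 * \<theta>)"
    have c: "0 < c" "inverse c = \<gamma>" using \<theta> \<sigma> by (auto simp: c_def \<gamma> divide_simps)
    have Zc: "continuous_on {0..} (\<lambda>t. Z t \<omega>)" using elim by simp
    have "((\<lambda>T. integral {0..T} (\<lambda>t. Z t \<omega>) / T) \<longlongrightarrow> c) at_top"
      unfolding c_def
      by (rule reflected_path_mean_tendsto[where l="drifted \<theta> \<sigma> \<omega>" and \<theta>=\<theta>]) (use elim \<theta> in auto)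
    moreover have "integral {0..T} (\<lambda>t. Z t \<omega>) = (LINT t:{0..T}|lborel. Z t \<omega>)" for T
      by (rule set_integral_eq_off_endpoint[symmetric]) (auto intro: continuous_on_subset[OF Zc])
    ultimately have "((\<lambda>T. 1 / T * (LINT t:{0..T}|lborel. Z t \<omega>)) \<longlongrightarrow> c) at_top" by simp
    from tendsto_max[OF tendsto_inverse[OF this] tendsto_const[of \<gamma>low]]
    have "((\<lambda>T. LTO_estimator \<gamma>low (\<lambda>t. Z t \<omega>) T) \<longlongrightarrow> max (inverse c) \<gamma>low) at_top"
      using c unfolding LTO_estimator_def by auto
    then show ?case using c low by (simp add: max_def)
  qed
qed

text \<open>
  Both adaptive algorithms estimate from the same epoch averages, which do not depend on how
  the barriers are chosen as long as these are bounded. The lower bound on the estimates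
  keeps the barriers in a compact interval.
\<close>

lemma adaptive_run_epoch_means:
  assumes \<theta>: "\<theta> < 0" and \<sigma>: "0 < \<sigma>"
    and low: "0 < \<gamma>low" and h: "admissible_cost \<gamma>low h"
    and est: "\<And>z r k. \<gamma>low \<le> est z r k"
    and run: "adaptive_run est M F B \<theta> \<sigma> h x Z r X g"
  shows "AE \<omega> in M. (\<lambda>k. (LINT s:{epoch k..epoch (Suc k)}|lborel. Z s \<omega> - r k \<omega>) / 2 ^ k) \<longlonglongrightarrow> \<sigma>\<^sup>2 / (- 2 * \<theta>)
    \<and> (\<forall>k. g (Suc k) \<omega> = est (\<lambda>t. Z t \<omega>) (\<lambda>i. r i \<omega>) k)"
proof -
  have s0: "\<sigma> \<noteq> 0" using \<sigma> by simp
  obtain K where K: "0 \<le> K" "\<And>u. \<gamma>low \<le> u \<Longrightarrow> barrier h u \<in> {- K..0}"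
    using barrier_bounded[OF h low] by blast
  from run have "\<forall>k. \<exists>Zk. \<exists>Yk. reflected_bm M F B \<theta> \<sigma> (epoch k) (r k) (X k) Zk Yk \<and>
              (AE \<omega> in M. \<forall>t\<in>{epoch k..<epoch (Suc k)}. Z t \<omega> = Zk t \<omega>)"
    unfolding adaptive_run_def by blast
  from choice[OF this] obtain W where run_W: "\<forall>k. \<exists>Yk. reflected_bm M F B \<theta> \<sigma> (epoch k) (r k) (X k) (W k) Yk \<and>
              (AE \<omega> in M. \<forall>t\<in>{epoch k..<epoch (Suc k)}. Z t \<omega> = W k t \<omega>)" by blast
  have W: "\<exists>Yk. reflected_bm M F B \<theta> \<sigma> (epoch k) (r k) (X k) (W k) Yk" for k using run_W by blast
  have ZW: "AE \<omega> in M. \<forall>t\<in>{epoch k..<epoch (Suc k)}. Z t \<omega> = W k t \<omega>" for k using run_W by blast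
  have "AE \<omega> in M. \<forall>k. reflected_path (drifted \<theta> \<sigma> \<omega>) (epoch k) (\<lambda>t. W k t \<omega> - r k \<omega>) \<and>
    continuous_on {epoch k..} (\<lambda>t. W k t \<omega>) \<and> W k (epoch k) \<omega> = X k \<omega>"
    unfolding AE_all_countable using W reflected_bm_path by blast
  moreover have "AE \<omega> in M. \<forall>k. \<forall>t\<in>{epoch k..<epoch (Suc k)}. Z t \<omega> = W k t \<omega>"
    unfolding AE_all_countable using ZW by blast
  moreover have "AE \<omega> in M. \<forall>k. g (Suc k) \<omega> = est (\<lambda>t. Z t \<omega>) (\<lambda>i. r i \<omega>) k \<and>
             r (Suc k) \<omega> = barrier h (g (Suc k) \<omega>) \<and>
             X (Suc k) \<omega> = max (Lim (at_left (epoch (Suc k))) (\<lambda>t. Z t \<omega>)) (r (Suc k) \<omega>)"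
    unfolding AE_all_countable using run unfolding adaptive_run_def by blast
  moreover have "AE \<omega> in M. r 0 \<omega> = 0" using run unfolding adaptive_run_def by auto
  ultimately show ?thesis
    using AE_continuous_drifted drifted_slope[of \<theta> \<sigma>] reflect_mean[OF \<theta> s0]
  proof eventually_elim
    case (elim \<omega>)
    define w where "w k t = W k t \<omega> - r k \<omega>" for k t
    have wp: "reflected_path (drifted \<theta> \<sigma> \<omega>) (epoch k) (w k)" for k
      using elim unfolding w_def[abs_def] by blast
    have wc: "continuous_on {epoch k..} (w k)" for k
      using elim unfolding w_def[abs_def] by (intro continuous_intros) blast
    have rK: "r k \<omega> \<in> {- K..0}" for k
    proof (cases k)
      case (Suc n)
      then show ?thesis using elim K(2)[OF est] by metis
    qed (use elim K in auto)
    have jump: "\<bar>w (Suc k) (epoch (Suc k)) - w k (epoch (Suc k))\<bar> \<le> K" for k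
    proof -
      have "Lim (at_left (epoch (Suc k))) (\<lambda>t. Z t \<omega>) = W k (epoch (Suc k)) \<omega>"
        by (rule Lim_at_left_eq[OF epoch_bounds(2)]) (use elim in auto)
      then have "w (Suc k) (epoch (Suc k)) = max (W k (epoch (Suc k)) \<omega>) (r (Suc k) \<omega>) - r (Suc k) \<omega>"
        using elim by (simp add: w_def)
      moreover have "0 \<le> w k (epoch (Suc k))"
        using wp[of k] epoch_bounds(2)[of k] unfolding reflected_path_def by (meson less_imp_le)
      ultimately show ?thesis using rK[of k] rK[of "Suc k"] by (auto simp: w_def max_def abs_le_iff)
    qed
    have "(\<lambda>k. integral {epoch k..epoch (Suc k)} (w k) / 2 ^ k) \<longlonglongrightarrow> \<sigma>\<^sup>2 / (- 2 * \<theta>)"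
      by (rule epoch_mean_tendsto[OF _ _ \<theta> _ wp wc jump]) (use elim in auto)
    moreover have "integral {epoch k..epoch (Suc k)} (w k) = (LINT s:{epoch k..epoch (Suc k)}|lborel. Z s \<omega> - r k \<omega>)" for k
    proof (rule set_integral_eq_off_endpoint[symmetric])
      show "continuous_on {epoch k..epoch (Suc k)} (w k)" by (rule continuous_on_subset[OF wc]) auto
    qed (use elim in \<open>auto simp: w_def\<close>)
    ultimately show ?case using elim by simp
  qed
qed

lemma AU_consistent:
  assumes \<theta>: "\<theta> < 0" and \<sigma>: "0 < \<sigma>" and \<gamma>: "\<gamma> = - 2 * \<theta> / \<sigma>\<^sup>2"
    and low: "0 < \<gamma>low" "\<gamma>low \<le> \<gamma>" and h: "admissible_cost \<gamma>low h"
    and run: "AU_run \<gamma>low M F B \<theta> \<sigma> h x Z r X g"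
  shows "AE \<omega> in M. (\<lambda>k. g k \<omega>) \<longlonglongrightarrow> \<gamma>"
proof -
  have "\<gamma>low \<le> AU_estimator \<gamma>low z r k" for z r k by (simp add: AU_estimator_def)
  from adaptive_run_epoch_means[OF \<theta> \<sigma> low(1) h this run[unfolded AU_run_def]]
  show ?thesis
  proof eventually_elim
    case (elim \<omega>)
    define c where "c = \<sigma>\<^sup>2 / (- 2 * \<theta>)"
    have c: "0 < c" "inverse c = \<gamma>" using \<theta> \<sigma> by (auto simp: c_def \<gamma> divide_simps)
    from elim have "(\<lambda>k. (LINT s:{epoch k..epoch (Suc k)}|lborel. Z s \<omega> - r k \<omega>) / 2 ^ k) \<longlonglongrightarrow> c"
      by (simp add: c_def)
    from tendsto_max[OF tendsto_inverse[OF this] tendsto_const[of \<gamma>low]]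
    have "(\<lambda>k. g (Suc k) \<omega>) \<longlonglongrightarrow> max (inverse c) \<gamma>low"
      using c elim by (simp add: AU_estimator_def epoch_len_def)
    then have "(\<lambda>k. g (Suc k) \<omega>) \<longlonglongrightarrow> \<gamma>" using c low by (simp add: max_def)
    then show ?case by (rule LIMSEQ_imp_Suc)
  qed
qed

text \<open>
  The full-history estimator is the weighted mean of the epoch averages with weights
  proportional to the epoch lengths.
\<close>

lemma AUFH_consistent:
  assumes \<theta>: "\<theta> < 0" and \<sigma>: "0 < \<sigma>" and \<gamma>: "\<gamma> = - 2 * \<theta> / \<sigma>\<^sup>2"
    and low: "0 < \<gamma>low" "\<gamma>low \<le> \<gamma>" and h: "admissible_cost \<gamma>low h"
    and run: "AUFH_run \<gamma>low M F B \<theta> \<sigma> h x Z r X g"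
  shows "AE \<omega> in M. (\<lambda>k. g k \<omega>) \<longlonglongrightarrow> \<gamma>"
proof -
  have "\<gamma>low \<le> AUFH_estimator \<gamma>low z r k" for z r k by (simp add: AUFH_estimator_def)
  from adaptive_run_epoch_means[OF \<theta> \<sigma> low(1) h this run[unfolded AUFH_run_def]]
  show ?thesis
  proof eventually_elim
    case (elim \<omega>)
    define c where "c = \<sigma>\<^sup>2 / (- 2 * \<theta>)"
    have c: "0 < c" "inverse c = \<gamma>" using \<theta> \<sigma> by (auto simp: c_def \<gamma> divide_simps)
    let ?D = "\<lambda>k. LINT s:{epoch k..epoch (Suc k)}|lborel. Z s \<omega> - r k \<omega>"
    from elim have "(\<lambda>k. ?D k / 2 ^ k) \<longlonglongrightarrow> c" by (simp add: c_def)
    from dyadic_weighted_mean_tendsto[OF this]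
    have "(\<lambda>k. (\<Sum>i=0..k. ?D i) / epoch (Suc k)) \<longlonglongrightarrow> c" by simp
    from tendsto_max[OF tendsto_inverse[OF this] tendsto_const[of \<gamma>low]]
    have "(\<lambda>k. g (Suc k) \<omega>) \<longlonglongrightarrow> max (inverse c) \<gamma>low"
      using c elim by (simp add: AUFH_estimator_def)
    then have "(\<lambda>k. g (Suc k) \<omega>) \<longlonglongrightarrow> \<gamma>" using c low by (simp add: max_def)
    then show ?case by (rule LIMSEQ_imp_Suc)
  qed
qed

end

theorem lemma10:
  fixes M :: "'a measure" and F :: "real \<Rightarrow> 'a measure" and B :: "real \<Rightarrow> 'a \<Rightarrow> real"
    and \<theta> \<sigma> \<gamma> \<gamma>low x :: real and h :: "real \<Rightarrow> real"
  assumes "filtered_prob_space M F"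
    and "standard_brownian_motion M F B"
    and "\<theta> < 0" and "\<sigma> > 0"
    and "\<gamma> = - 2 * \<theta> / \<sigma>\<^sup>2"
    and "0 < \<gamma>low" and "\<gamma>low \<le> \<gamma>"
    and "admissible_cost \<gamma>low h"
    and "0 \<le> x"
  shows
    "(\<forall>Z Y. reflected_bm M F B \<theta> \<sigma> 0 (\<lambda>_. 0) (\<lambda>_. x) Z Y \<longrightarrow>
        (AE \<omega> in M. ((\<lambda>\<tau>. LTO_estimator \<gamma>low (\<lambda>t. Z t \<omega>) \<tau>) \<longlongrightarrow> \<gamma>) at_top)) \<and>
     (\<forall>Z r X g. AU_run \<gamma>low M F B \<theta> \<sigma> h x Z r X g \<longrightarrow>
        (AE \<omega> in M. (\<lambda>k. g k \<omega>) \<longlonglongrightarrow> \<gamma>)) \<and>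
     (\<forall>Z r X g. AUFH_run \<gamma>low M F B \<theta> \<sigma> h x Z r X g \<longrightarrow>
        (AE \<omega> in M. (\<lambda>k. g k \<omega>) \<longlonglongrightarrow> \<gamma>))"
proof -
  interpret prob_space M using assms(1) by (simp add: filtered_prob_space_def)
  interpret brownian M F B by unfold_locales (use assms in auto)
  show ?thesis
    using LTO_consistent[OF assms(3,4,5,7)] AU_consistent[OF assms(3-8)] AUFH_consistent[OF assms(3-8)]
    by blast
qed

end
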